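(* For each integer $k\geqslant 0$ let $\mathrm{M}_k=\mathrm{M}\cap\mathbf{Z}^{\mathcal{B}_k}$. Then for each $k\geqslant1$, $$\mathrm{M}_k=\alpha_k^{-1}\Big(\bigoplus_{0\leqslant k'<k}\mathrm{M}_{k'}\Big)=\bigcap_{0\leqslant k'<k}\alpha_{k',k}^{-1}(\mathrm{M}_{k'}).$$
   Context: A composition is a finite sequence $\mathbf{a}=(a_1,\ldots,a_r)$ of positive integers ($r\geqslant0$), of weight $\sum a_i$; admissible if $r=0$ or $a_1\geqslant2$. $\mathcal{A}$ is the set of admissible compositions. Binary word $\mathbf{w}(\mathbf{a})=0^{a_1-1}1\cdots0^{a_r-1}1$; the dual of a word $\varepsilon_1\cdots\varepsilon_k$ is $\overline{\varepsilon_k}\cdots\overline{\varepsilon_1}$ ($\overline0=1,\overline1=0$); $\overline{\mathbf{a}}$ is the admissible composition with word dual to $\mathbf{w}(\mathbf{a})$. $\mathcal{B}=\mathcal{A}/(\mathbf{a}\sim\overline{\mathbf{a}})$ with classes $[\mathbf{a}]$, $\mathcal{B}_k$ the classes of weight $k$, $\mathcal{B}^*=\mathcal{B}\setminus\{[\varnothing]\}$; $\mathbf{Z}^{(X)}$ is the free $\mathbf{Z}$-module on $X$. $(a_1,\ldots,a_r)^{\rm init}=(a_1,\ldots,a_{r-1})$; for admissible $\mathbf{a}$, $\mathbf{a}^{\rm fin}$ is the dual of $(\overline{\mathbf{a}})^{\rm init}$ and $\mathbf{a}^{\rm mid}=(\mathbf{a}^{\rm fin})^{\rm init}$. $\alpha:\mathbf{Z}^{(\mathcal{B}^*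 )}\to\mathbf{Z}^{(\mathcal{B})}$ is the $\mathbf{Z}$-linear map $[\mathbf{a}]\mapsto[\mathbf{a}^{\rm init}]+[\mathbf{a}^{\rm mid}]+[\mathbf{a}^{\rm fin}]$ (well defined); for $k\geqslant1$ it induces $\alpha_k:\mathbf{Z}^{\mathcal{B}_k}\to\bigoplus_{0\leqslant k'<k}\mathbf{Z}^{\mathcal{B}_{k'}}$, whose $k'$-component is denoted $\alpha_{k',k}:\mathbf{Z}^{\mathcal{B}_k}\to\mathbf{Z}^{\mathcal{B}_{k'}}$. For non-empty admissible $\mathbf{a}$ and $n\geqslant0$, $\zeta(\mathbf{a})_{n,n}=\sum_{n_1>\cdots>n_r>n}\binom{n_1+n}{n}^{-1}n_1^{-a_1}\cdots n_r^{-a_r}$, $\zeta(\varnothing)_{n,n}=\binom{2n}{n}^{-1}$; since $\zeta(\mathbf{a})_{n,n}=\zeta(\overline{\mathbf{a}})_{n,n}$ this gives a $\mathbf{Z}$-linear map $\ell\mapsto\zeta(\ell)_{n,n}$ on $\mathbf{Z}^{(\mathcal{B})}$. $\mathrm{M}$ is the set of $\ell\in\mathbf{Z}^{(\mathcal{B})}$ with $\zeta(\ell)_{n,n}=0$ for all $n\geqslant0$. *)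

theory Defs
  imports "HOL-Analysis.Analysis" "HOL-Algebra.Free_Abelian_Groups"
begin

definition compositions :: "nat list set" where
  "compositions = {a. \<forall>x\<in>set a. 0 < x}"

definition weight :: "nat list \<Rightarrow> nat" where
  "weight a = sum_list a"

definition admissible :: "nat list set" where
  "admissible = {a \<in> compositions. a = [] \<or> 2 \<le> hd a}"

text \<open>Binary words: the letter 0 is \<^term>\<open>False\<close>, the letter 1 is \<^term>\<open>True\<close>.\<close>

definition comp_word :: "nat list \<Rightarrow> bool list" where
  "comp_word a = concat (map (\<lambda>x. replicate (x - 1) False @ [True]) a)"

definition dual_word :: "bool list \<Rightarrow> bool list" where
  "dual_word w = rev (map Not w)"

definition dual :: "nat list \<Rightarrow> nat list" where
  "dual a = (THE b. b \<in> admissible \<and> comp_word b = dual_word (comp_word a))"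

text \<open>The convention for the empty composition is that its initial part is empty
  (\<^term>\<open>butlast []\<close> is \<^term>\<open>[]\<close>); it is needed for the middle part of the
  composition \<^term>\<open>[2]\<close>, whose image under \<open>alpha\<close> is three times the class of \<^term>\<open>[]\<close>.\<close>

definition comp_init :: "nat list \<Rightarrow> nat list" where
  "comp_init a = butlast a"

definition comp_fin :: "nat list \<Rightarrow> nat list" where
  "comp_fin a = dual (comp_init (dual a))"

definition comp_mid :: "nat list \<Rightarrow> nat list" where
  "comp_mid a = comp_init (comp_fin a)"

definition dual_rel :: "(nat list \<times> nat list) set" where
  "dual_rel = {(a, b). a \<in> admissible \<and> b \<in> admissible \<and> (b = a \<or> b = dual a)}"

definition cls :: "nat list \<Rightarrow> nat list set" where
  "cls a = dual_rel `` {a}"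

definition dual_classes :: "nat list set set" where
  "dual_classes = admissible // dual_rel"

definition dual_classes_wt :: "nat \<Rightarrow> nat list set set" where
  "dual_classes_wt k = {cls a | a. a \<in> admissible \<and> weight a = k}"

abbreviation free_Z :: "'a set \<Rightarrow> ('a \<Rightarrow>\<^sub>0 int) set" where
  "free_Z X \<equiv> carrier (free_Abelian_group X)"

text \<open>A map on admissible compositions that is invariant under duality induces a map on
  classes, whose value at a class \<open>c\<close> is the unique element of the image of \<open>c\<close>.
  The map \<open>alpha\<close> is only meaningful on combinations of classes
  other than the class of \<^term>\<open>[]\<close>.\<close>

definition alpha_class :: "nat list set \<Rightarrow> (nat list set \<Rightarrow>\<^sub>0 int)" where
  "alpha_class c = the_elem ((\<lambda>a. frag_of (cls (comp_init a)) + frag_of (cls (comp_mid a))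
                                 + frag_of (cls (comp_fin a))) ` c)"

definition alpha :: "(nat list set \<Rightarrow>\<^sub>0 int) \<Rightarrow> (nat list set \<Rightarrow>\<^sub>0 int)" where
  "alpha = frag_extend alpha_class"

definition wt_component :: "nat \<Rightarrow> (nat list set \<Rightarrow>\<^sub>0 int) \<Rightarrow> (nat list set \<Rightarrow>\<^sub>0 int)" where
  "wt_component k = frag_extend (\<lambda>c. if c \<in> dual_classes_wt k then frag_of c else 0)"

text \<open>The direct sum of the modules \<^term>\<open>free_Z (dual_classes_wt k')\<close> for \<open>k' < k\<close> is taken
  inside \<^term>\<open>free_Z dual_classes\<close>.  Accordingly \<open>alpha_wt k\<close> is \<open>alpha\<close> with domain
  \<^term>\<open>free_Z (dual_classes_wt k)\<close>, and \<open>alpha_comp k' k\<close> is its component of weight \<open>k'\<close>.\<close>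

definition alpha_wt :: "nat \<Rightarrow> (nat list set \<Rightarrow>\<^sub>0 int) \<Rightarrow> (nat list set \<Rightarrow>\<^sub>0 int)" where
  "alpha_wt k = restrict alpha (free_Z (dual_classes_wt k))"

definition alpha_comp :: "nat \<Rightarrow> nat \<Rightarrow> (nat list set \<Rightarrow>\<^sub>0 int) \<Rightarrow> (nat list set \<Rightarrow>\<^sub>0 int)" where
  "alpha_comp k' k = restrict (\<lambda>l. wt_component k' (alpha_wt k l)) (free_Z (dual_classes_wt k))"

definition decreasing_tuples :: "nat \<Rightarrow> nat \<Rightarrow> nat list set" where
  "decreasing_tuples r n = {ns. length ns = r \<and> sorted_wrt (>) ns \<and> (\<forall>m\<in>set ns. n < m)}"

definition zeta_tail :: "nat list \<Rightarrow> nat \<Rightarrow> real" where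
  "zeta_tail a n =
     (if a = [] then 1 / real ((2 * n) choose n)
      else \<Sum>\<^sub>\<infinity>ns\<in>decreasing_tuples (length a) n.
             1 / real ((hd ns + n) choose n) * (\<Prod>i<length a. 1 / real (ns ! i) ^ (a ! i)))"

definition zeta_class :: "nat list set \<Rightarrow> nat \<Rightarrow> real" where
  "zeta_class c n = the_elem ((\<lambda>a. zeta_tail a n) ` c)"

definition zeta_lin :: "(nat list set \<Rightarrow>\<^sub>0 int) \<Rightarrow> nat \<Rightarrow> real" where
  "zeta_lin l n = (\<Sum>c\<in>Poly_Mapping.keys l. of_int (Poly_Mapping.lookup l c) * zeta_class c n)"

definition rel_M :: "(nat list set \<Rightarrow>\<^sub>0 int) set" where
  "rel_M = {l \<in> free_Z dual_classes. \<forall>n. zeta_lin l n = 0}"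

definition rel_M_wt :: "nat \<Rightarrow> (nat list set \<Rightarrow>\<^sub>0 int) set" where
  "rel_M_wt k = rel_M \<inter> free_Z (dual_classes_wt k)"

definition internal_sum_below :: "nat \<Rightarrow> (nat \<Rightarrow> ('a \<Rightarrow>\<^sub>0 int) set) \<Rightarrow> ('a \<Rightarrow>\<^sub>0 int) set" where
  "internal_sum_below k N = {\<Sum>j<k. m j | m. \<forall>j<k. m j \<in> N j}"

end

(* Cutting off the outermost or innermost summation variable gives, for admissible a of weight k,

     zeta(a)_{n-1,n-1} = zeta(a)_{n,n} + sum over b in {init a, mid a, fin a} of
                                         n^(wt b - k) * zeta(b)_{n,n},

   so zeta(l)_{n-1,n-1} - zeta(l)_{n,n} is the sum of n^(k' - k) zeta(alpha_{k',k} l)_{n,n}. If all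
   components of alpha l are relations, then zeta(l)_{n,n} is constant, and it tends to 0.

   Conversely, functions zeta(.)_{n,n} of different weights have to be separated. A maximal family of
   compositions independent over the rational functions of n already spans, with constant
   coefficients, within each weight: shifting n in a dependence relation yields difference equations
   P(n) - P(n-1) = sum of e_d n^(-d) for the rational coefficients (with 4 - 2/n in front of P(n-1) in
   weight 0), which force P to be constant and all e_d to vanish, by looking at the poles of P.

   Duality of the double tails is proved with the connector n! m! / (n+m)!: every letter of the
   binary word, acting on the variable n, can be traded for the opposite letter acting on m. *)

theory Submission
  imports Defs "HOL-Computational_Algebra.Fundamental_Theorem_Algebra"
begin

text \<open>Vanishing of the sum of n^(k' - k) zeta(alpha_{k',k} l)_{n,n} says nothing about a
  single k' until it is known that different weights cannot compensate each other. Constancy of the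
  coefficients is what makes the separation possible: the powers of n then stay attached to the
  weights and can be compared basis element by basis element. Weight 0 stands apart because
  1/binomial(2n, n) obeys a homogeneous recursion with a factor different from 1.

  Rational functions are taken as germs at infinity, so the separation yields zeros for large n
  only, while membership in M asks for every n. An induction on the weight closes this gap.
  Coefficients are complex so that a denominator without roots is constant.

  For duality the diagonal is too narrow: trading one letter of a word needs two independent
  variables n and m. The sums have values in \<open>ennreal\<close>, so that they can be
  interchanged before any convergence is known; finiteness for admissible compositions comes out
  afterwards from a bound by the connector.\<close>

section \<open>Difference equations for rational functions\<close>

text \<open>The field of rational functions, realized on sequences up to finitely many terms. A
  rational function is determined by its values at large integers, and the zeros of the denominator
  play no part there.\<close>

definition rational_germ :: "(nat \<Rightarrow> complex) \<Rightarrow> bool" where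
  "rational_germ f \<longleftrightarrow>
     (\<exists>p q. q \<noteq> 0 \<and> (\<forall>\<^sub>F n in sequentially. f n = poly p (of_nat n) / poly q (of_nat n)))"

section \<open>The field of germs of rational functions\<close>

lemma eventually_poly_nonzero:
  fixes q :: "complex poly"
  assumes "q \<noteq> 0"
  shows "\<forall>\<^sub>F n in sequentially. poly q (of_nat n) \<noteq> 0"
proof -
  have "finite (of_nat -` {x. poly q x = 0} :: nat set)"
    by (rule finite_vimageI[OF poly_roots_finite[OF assms]]) (auto simp: inj_on_def)
  moreover have "(of_nat -` {x. poly q x = 0} :: nat set) = {n. \<not> poly q (of_nat n) \<noteq> 0}"
    by auto
  ultimately show ?thesis
    unfolding cofinite_eq_sequentially[symmetric] eventually_cofinite by simp
qed

lemma poly_eq_if_eventually: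
  fixes p q :: "complex poly"
  assumes "\<forall>\<^sub>F n in sequentially. poly p (of_nat n) = poly q (of_nat n)"
  shows "p = q"
proof (rule ccontr)
  assume "p \<noteq> q"
  then have "p - q \<noteq> 0" by simp
  from eventually_poly_nonzero[OF this] assms
  have "\<forall>\<^sub>F n::nat in sequentially. False" by eventually_elim simp
  then show False by simp
qed

lemma rational_germ_cong:
  assumes "rational_germ f" "\<forall>\<^sub>F n in sequentially. g n = f n"
  shows "rational_germ g"
proof -
  from assms(1) obtain p q where "q \<noteq> 0"
    and e: "\<forall>\<^sub>F n in sequentially. f n = poly p (of_nat n) / poly q (of_nat n)"
    unfolding rational_germ_def by blast
  moreover have "\<forall>\<^sub>F n in sequentially. g n = poly p (of_nat n) / poly q (of_nat n)"
    using e assms(2) by eventually_elim simp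
  ultimately show ?thesis unfolding rational_germ_def by blast
qed

lemma rational_germ_poly_div:
  "q \<noteq> 0 \<Longrightarrow> rational_germ (\<lambda>n. poly p (of_nat n) / poly q (of_nat n))"
  unfolding rational_germ_def by (intro exI[of _ p] exI[of _ q]) simp

lemma rational_germ_const: "rational_germ (\<lambda>n. c)"
  using rational_germ_poly_div[of 1 "[:c:]"] by simp

lemma rational_germ_inverse_power: "rational_germ (\<lambda>n. inverse (of_nat n) ^ d)"
  using rational_germ_poly_div[of "monom 1 d" 1]
  by (simp add: poly_monom monom_eq_0_iff field_simps)

lemma rational_germ_add:
  assumes "rational_germ f" "rational_germ g"
  shows "rational_germ (\<lambda>n. f n + g n)"
proof -
  from assms obtain p q p' q' where q: "q \<noteq> 0" "q' \<noteq> 0"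
    and f: "\<forall>\<^sub>F n in sequentially. f n = poly p (of_nat n) / poly q (of_nat n)"
    and g: "\<forall>\<^sub>F n in sequentially. g n = poly p' (of_nat n) / poly q' (of_nat n)"
    unfolding rational_germ_def by blast
  have "\<forall>\<^sub>F n in sequentially.
      f n + g n = poly (p * q' + p' * q) (of_nat n) / poly (q * q') (of_nat n)"
    using f g eventually_poly_nonzero[OF q(1)] eventually_poly_nonzero[OF q(2)]
    by eventually_elim (simp add: add_frac_eq)
  with q show ?thesis
    by (intro rational_germ_cong[OF rational_germ_poly_div[of "q * q'" "p * q' + p' * q"]]) auto
qed

lemma rational_germ_mult:
  assumes "rational_germ f" "rational_germ g"
  shows "rational_germ (\<lambda>n. f n * g n)"
proof -
  from assms obtain p q p' q' where q: "q \<noteq> 0" "q' \<noteq> 0"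
    and f: "\<forall>\<^sub>F n in sequentially. f n = poly p (of_nat n) / poly q (of_nat n)"
    and g: "\<forall>\<^sub>F n in sequentially. g n = poly p' (of_nat n) / poly q' (of_nat n)"
    unfolding rational_germ_def by blast
  have "\<forall>\<^sub>F n in sequentially. f n * g n = poly (p * p') (of_nat n) / poly (q * q') (of_nat n)"
    using f g by eventually_elim simp
  with q show ?thesis
    by (intro rational_germ_cong[OF rational_germ_poly_div[of "q * q'" "p * p'"]]) auto
qed

lemma rational_germ_inverse:
  assumes "rational_germ f"
  shows "rational_germ (\<lambda>n. inverse (f n))"
proof -
  from assms obtain p q where q: "q \<noteq> 0"
    and f: "\<forall>\<^sub>F n in sequentially. f n = poly p (of_nat n) / poly q (of_nat n)"
    unfolding rational_germ_def by blast
  show ?thesis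
  proof (cases "p = 0")
    case True
    with f show ?thesis
      by (intro rational_germ_cong[OF rational_germ_const[of 0]]) (auto elim: eventually_mono)
  next
    case False
    show ?thesis
      by (rule rational_germ_cong[OF rational_germ_poly_div[OF False, of q]])
        (use f in \<open>auto elim: eventually_mono\<close>)
  qed
qed

lemma rational_germ_sum:
  "(\<And>i. i \<in> A \<Longrightarrow> rational_germ (f i)) \<Longrightarrow> rational_germ (\<lambda>n. \<Sum>i\<in>A. f i n)"
  by (induction A rule: infinite_finite_induct)
    (auto intro: rational_germ_const rational_germ_add)

lemma rational_germ_uminus: "rational_germ f \<Longrightarrow> rational_germ (\<lambda>n. - f n)"
  using rational_germ_mult[OF rational_germ_const[of "-1"], of f] by simp

lemma rational_germ_diff:
  "rational_germ f \<Longrightarrow> rational_germ g \<Longrightarrow> rational_germ (\<lambda>n. f n - g n)"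
  using rational_germ_add[of f "\<lambda>n. - g n"] rational_germ_uminus[of g] by simp

lemma eventually_pred:
  assumes "\<forall>\<^sub>F n in sequentially. P n"
  shows "\<forall>\<^sub>F n in sequentially. P (n - 1 :: nat)"
proof -
  from assms obtain N where N: "\<And>n. n \<ge> N \<Longrightarrow> P n"
    unfolding eventually_sequentially by blast
  show ?thesis unfolding eventually_sequentially by (rule exI[of _ "Suc N"]) (auto intro: N)
qed

lemma rational_germ_pred:
  assumes "rational_germ f"
  shows "rational_germ (\<lambda>n. f (n - 1))"
proof -
  from assms obtain p q where q: "q \<noteq> 0"
    and f: "\<forall>\<^sub>F n in sequentially. f n = poly p (of_nat n) / poly q (of_nat n)"
    unfolding rational_germ_def by blast
  let ?h = "[:-1, 1:] :: complex poly"
  have "pcompose q ?h \<noteq> 0"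
    using q by (simp add: pcompose_eq_0_iff)
  moreover have "\<forall>\<^sub>F n in sequentially.
      f (n - 1) = poly (pcompose p ?h) (of_nat n) / poly (pcompose q ?h) (of_nat n)"
    using eventually_pred[OF f] eventually_ge_at_top[of 1]
    by eventually_elim (simp add: poly_pcompose of_nat_diff)
  ultimately show ?thesis
    by (intro rational_germ_cong[OF rational_germ_poly_div[of "pcompose q ?h" "pcompose p ?h"]])
qed

text \<open>A nonzero numerator has only finitely many roots. Hence a germ that is not eventually
  zero can be inverted, which is what allows division by a coefficient of a dependence
  relation.\<close>

lemma rational_germ_zero_or_nonzero:
  assumes "rational_germ f"
  shows "(\<forall>\<^sub>F n in sequentially. f n = 0) \<or> (\<forall>\<^sub>F n in sequentially. f n \<noteq> 0)"
proof -
  from assms obtain p q where q: "q \<noteq> 0"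
    and f: "\<forall>\<^sub>F n in sequentially. f n = poly p (of_nat n) / poly q (of_nat n)"
    unfolding rational_germ_def by blast
  show ?thesis
  proof (cases "p = 0")
    case True
    with f show ?thesis by (auto elim: eventually_mono)
  next
    case False
    have "\<forall>\<^sub>F n in sequentially. f n \<noteq> 0"
      using f eventually_poly_nonzero[OF q] eventually_poly_nonzero[OF False]
      by eventually_elim simp
    then show ?thesis by simp
  qed
qed

text \<open>A denominator of least degree has no root in common with its numerator, since a common
  linear factor could be cancelled.\<close>

lemma rational_germ_reduced:
  assumes "rational_germ f"
  obtains p q where "q \<noteq> 0" "\<And>x. poly q x = 0 \<Longrightarrow> poly p x \<noteq> 0"
    "\<forall>\<^sub>F n in sequentially. f n = poly p (of_nat n) / poly q (of_nat n)"
proof -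
  define R where "R p q \<longleftrightarrow> q \<noteq> 0 \<and>
    (\<forall>\<^sub>F n in sequentially. f n = poly p (of_nat n) / poly q (of_nat n))" for p q
  define D where "D d \<longleftrightarrow> (\<exists>p q. R p q \<and> degree q = d)" for d
  have "\<exists>d. D d" using assms unfolding rational_germ_def D_def R_def by blast
  then have "D (LEAST d. D d)" by (metis LeastI)
  then obtain p q where R: "R p q" and deg: "degree q = (LEAST d. D d)"
    unfolding D_def by blast
  have "poly p a \<noteq> 0" if "poly q a = 0" for a
  proof
    assume "poly p a = 0"
    then obtain p' where p': "p = [:-a, 1:] * p'" by (auto simp: poly_eq_0_iff_dvd dvd_def)
    from \<open>poly q a = 0\<close> obtain q' where q': "q = [:-a, 1:] * q'"
      by (auto simp: poly_eq_0_iff_dvd dvd_def)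
    have "q' \<noteq> 0" using R q' unfolding R_def by auto
    have "\<forall>\<^sub>F n in sequentially. f n = poly p (of_nat n) / poly q (of_nat n)"
      using R unfolding R_def by blast
    moreover have "\<forall>\<^sub>F n in sequentially. poly [:-a, 1:] (of_nat n) \<noteq> 0"
      by (rule eventually_poly_nonzero) simp
    ultimately have "\<forall>\<^sub>F n in sequentially. f n = poly p' (of_nat n) / poly q' (of_nat n)"
      by eventually_elim (simp only: p' q' poly_mult mult_divide_mult_cancel_left_if if_False)
    with \<open>q' \<noteq> 0\<close> have "D (degree q')" unfolding D_def R_def by blast
    then have "degree q \<le> degree q'" unfolding deg by (rule Least_le)
    moreover have "degree q = Suc (degree q')"
      unfolding q' using \<open>q' \<noteq> 0\<close> by (subst degree_mult_eq) auto
    ultimately show False by simp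
  qed
  with R that show ?thesis unfolding R_def by blast
qed

section \<open>First-order difference equations and their polynomial solutions\<close>

lemma poly_eq_0_if_tendsto_0:
  fixes p :: "complex poly"
  assumes "(\<lambda>n. poly p (of_nat n)) \<longlonglongrightarrow> 0"
  shows "p = 0"
proof (cases "degree p = 0")
  case True
  then obtain c where "p = [:c:]" by (rule degree_eq_zeroE)
  with assms show ?thesis by (simp add: LIMSEQ_const_iff)
next
  case False
  have "(\<lambda>n. poly p (of_nat n) / of_nat n ^ degree p) \<longlonglongrightarrow> lead_coeff p"
    by (rule filterlim_compose[OF poly_divide_tendsto_aux tendsto_of_nat])
  moreover have "(\<lambda>n. poly p (of_nat n) * (inverse (of_nat n)) ^ degree p) \<longlonglongrightarrow> 0 * 0 ^ degree p"
    by (intro tendsto_intros assms lim_inverse_n)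
  ultimately have "lead_coeff p = 0"
    using False by (auto simp: divide_inverse power_inverse simp del: leading_coeff_0_iff intro: LIMSEQ_unique)
  then show ?thesis by simp
qed

text \<open>Multiplication by n^J turns the sum into a polynomial with the same coefficients in
  reverse order, and this polynomial has infinitely many roots.\<close>

lemma inverse_power_sum_coeffs_zero:
  fixes e :: "nat \<Rightarrow> complex"
  assumes "\<forall>\<^sub>F n in sequentially. (\<Sum>d=1..J. e d * inverse (of_nat n) ^ d) = 0"
    and "1 \<le> d" "d \<le> J"
  shows "e d = 0"
proof -
  define E where "E = (\<Sum>d=1..J. monom (e d) (J - d))"
  have "\<forall>\<^sub>F n in sequentially. poly E (of_nat n) = poly 0 (of_nat n)"
    using assms(1) eventually_gt_at_top[of 0]
  proof eventually_elim
    case (elim n)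
    have "poly E (of_nat n) = (\<Sum>d=1..J. e d * inverse (of_nat n) ^ d) * of_nat n ^ J"
      unfolding E_def poly_sum poly_monom sum_distrib_right
      using elim(2) by (intro sum.cong) (auto simp: power_diff field_simps)
    with elim(1) show ?case by simp
  qed
  then have "E = 0" by (rule poly_eq_if_eventually)
  then have "coeff E (J - d) = 0" by simp
  moreover have "coeff E (J - d) = (\<Sum>d'=1..J. if d' = d then e d' else 0)"
    unfolding E_def coeff_sum using assms(3) by (intro sum.cong) auto
  ultimately show ?thesis using assms by simp
qed

lemma inverse_power_sum_tendsto_0:
  fixes e :: "nat \<Rightarrow> complex"
  shows "(\<lambda>n. \<Sum>d=1..J. e d * inverse (of_nat n) ^ d) \<longlonglongrightarrow> 0"
proof -
  have "(\<lambda>n. \<Sum>d=1..J. e d * inverse (of_nat n) ^ d) \<longlonglongrightarrow> (\<Sum>d=1..J. e d * 0 ^ d)"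
    by (intro tendsto_intros lim_inverse_n)
  moreover have "(\<Sum>d=1..J. e d * 0 ^ d) = 0" by (intro sum.neutral) auto
  ultimately show ?thesis by simp
qed

text \<open>The right-hand side has its only pole at 0, so a pole of the reduced solution can be moved
  down by 1 unless it is 0, and up by 1 unless it is \<open>-1\<close> or a zero of \<open>\<alpha> (x + 1) + \<beta>\<close>. Going down
  it reaches 0, and from there it goes up forever.\<close>

lemma rational_difference_equation_poly:
  fixes \<alpha> \<beta> :: complex
  assumes "rational_germ f"
    and nz: "\<And>m::nat. \<alpha> * of_nat (Suc m) + \<beta> \<noteq> 0"
    and eq: "\<forall>\<^sub>F n in sequentially. f n - (\<alpha> + \<beta> / of_nat n) * f (n - 1)
              = (\<Sum>d=1..J. e d * inverse (of_nat n) ^ d)"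
  obtains p where "\<forall>\<^sub>F n in sequentially. f n = poly p (of_nat n)"
proof -
  obtain p q where q: "q \<noteq> 0" and red: "\<And>x. poly q x = 0 \<Longrightarrow> poly p x \<noteq> 0"
    and f: "\<forall>\<^sub>F n in sequentially. f n = poly p (of_nat n) / poly q (of_nat n)"
    using rational_germ_reduced[OF assms(1)] by metis
  define E where "E = (\<Sum>d=1..J. monom (e d) (J - d))"
  let ?h = "[:-1, 1:] :: complex poly"
  let ?p' = "pcompose p ?h" and ?q' = "pcompose q ?h"
  have "?q' \<noteq> 0" using q by (simp add: pcompose_eq_0_iff)
  \<comment> \<open>The equation multiplied by x^(J+1) q(x) q(x-1). As an identity of polynomials
    valid at all large integers it extends to every complex point, in particular to the
    poles.\<close>
  have "monom 1 (Suc J) * p * ?q' - monom 1 J * [:\<beta>, \<alpha>:] * ?p' * q = [:0, 1:] * E * q * ?q'"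
  proof (rule poly_eq_if_eventually)
    show "\<forall>\<^sub>F n in sequentially.
      poly (monom 1 (Suc J) * p * ?q' - monom 1 J * [:\<beta>, \<alpha>:] * ?p' * q) (of_nat n)
      = poly ([:0, 1:] * E * q * ?q') (of_nat n)"
      using eq f eventually_pred[OF f] eventually_poly_nonzero[OF q]
        eventually_poly_nonzero[OF \<open>?q' \<noteq> 0\<close>] eventually_gt_at_top[of 0]
    proof eventually_elim
      case (elim n)
      define x where "x = (of_nat n :: complex)"
      have "x \<noteq> 0" using elim unfolding x_def by simp
      have pred: "of_nat (n - 1) = x - 1" using elim unfolding x_def by (simp add: of_nat_diff)
      have E: "poly E x = (\<Sum>d=1..J. e d * inverse x ^ d) * x ^ J"
        unfolding E_def poly_sum poly_monom sum_distrib_right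
        using \<open>x \<noteq> 0\<close> by (intro sum.cong) (auto simp: power_diff field_simps)
      have nzq: "poly q x \<noteq> 0" "poly q (x - 1) \<noteq> 0"
        using elim by (auto simp: x_def poly_pcompose)
      have main: "poly p x / poly q x - (\<alpha> + \<beta> / x) * (poly p (x - 1) / poly q (x - 1))
          = (\<Sum>d=1..J. e d * inverse x ^ d)"
        using elim(1-3) unfolding pred unfolding x_def by simp
      have "x * x ^ J * poly p x * poly q (x - 1) - x ^ J * (\<beta> + x * \<alpha>) * poly p (x - 1) * poly q x
         = x * x ^ J * poly q x * poly q (x - 1) *
           (poly p x / poly q x - (\<alpha> + \<beta> / x) * (poly p (x - 1) / poly q (x - 1)))"
        using nzq \<open>x \<noteq> 0\<close> by (simp add: field_simps)
      then have "x * x ^ J * poly p x * poly q (x - 1) - x ^ J * (\<beta> + x * \<alpha>) * poly p (x - 1) * poly q x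
          = x * poly E x * poly q x * poly q (x - 1)"
        unfolding main E by (simp only: mult_ac)
      then show ?case
        unfolding x_def[symmetric]
        by (simp only: poly_diff poly_mult poly_monom poly_pcompose poly_pCons poly_0) simp
    qed
  qed
  note polyid = this
  have id: "x ^ Suc J * poly p x * poly q (x - 1)
      - x ^ J * (\<beta> + x * \<alpha>) * poly p (x - 1) * poly q x = x * poly E x * poly q x * poly q (x - 1)" for x
    using arg_cong[OF polyid, of "\<lambda>r. poly r x"]
    by (simp only: poly_diff poly_mult poly_monom poly_pcompose poly_pCons poly_0) simp
  define Z where "Z = {x. poly q x = 0}"
  have "finite Z" unfolding Z_def by (rule poly_roots_finite[OF q])
  \<comment> \<open>At a root a of q, two of the three terms of \<open>id\<close> contain q(a); what
    remains is a^(J+1) p(a) q(a-1) = 0.\<close>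
  have down: "a - 1 \<in> Z" if "a \<in> Z" "a \<noteq> 0" for a
    using id[of a] red[of a] that unfolding Z_def by simp
  \<comment> \<open>Here q vanishes at x - 1 = m, which removes the other two terms. The assumption
    \<open>nz\<close> keeps the factor \<alpha> x + \<beta> away from 0 at x = m + 1.\<close>
  have up: "of_nat (Suc m) \<in> Z" if "of_nat m \<in> Z" for m
  proof -
    let ?x = "of_nat (Suc m) :: complex"
    have x: "?x - 1 = of_nat m" by simp
    have "?x ^ J * (\<beta> + ?x * \<alpha>) * poly p (of_nat m) * poly q ?x = 0"
      using id[of ?x] that unfolding x Z_def by simp
    moreover have "?x ^ J \<noteq> 0" "\<beta> + ?x * \<alpha> \<noteq> 0" "poly p (of_nat m) \<noteq> 0"
      using nz[of m] red[of "of_nat m"] that unfolding Z_def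
      by (simp_all add: add.commute mult.commute del: of_nat_Suc)
    ultimately show ?thesis unfolding Z_def by (simp del: of_nat_Suc)
  qed
  have "Z = {}"
  proof (rule ccontr)
    assume "Z \<noteq> {}"
    then obtain a where "a \<in> Z" by blast
    have "\<exists>m. of_nat m \<in> Z"
    proof (rule ccontr)
      assume *: "\<nexists>m. of_nat m \<in> Z"
      have "a - of_nat m \<in> Z" for m
      proof (induction m)
        case 0
        show ?case using \<open>a \<in> Z\<close> by simp
      next
        case (Suc m)
        then have "a - of_nat m \<noteq> 0" using * by (metis of_nat_0)
        from down[OF Suc this] show ?case by (simp add: algebra_simps)
      qed
      then have "range (\<lambda>m::nat. a - of_nat m) \<subseteq> Z" by blast
      then have "finite (range (\<lambda>m::nat. a - of_nat m))" using \<open>finite Z\<close> by (rule finite_subset)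
      moreover have "inj (\<lambda>m::nat. a - of_nat m)" by (auto simp: inj_on_def)
      ultimately show False using finite_imageD by blast
    qed
    then obtain k where k: "of_nat k \<in> Z" by blast
    have "of_nat (k + m) \<in> Z" for m
    proof (induction m)
      case 0
      show ?case using k by simp
    next
      case (Suc m)
      from up[OF this] show ?case by (simp only: add_Suc_right)
    qed
    then have "range (\<lambda>m. of_nat (k + m) :: complex) \<subseteq> Z" by blast
    then have "finite (range (\<lambda>m. of_nat (k + m) :: complex))"
      using \<open>finite Z\<close> by (rule finite_subset)
    moreover have "inj (\<lambda>m. of_nat (k + m) :: complex)" by (auto simp: inj_on_def)
    ultimately show False using finite_imageD by blast
  qed
  then have "constant (poly q)"
    using fundamental_theorem_of_algebra[of q] unfolding Z_def by blast
  then have "degree q = 0" by (simp add: constant_degree)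
  then obtain c where c: "q = [:c:]" by (rule degree_eq_zeroE)
  have "\<forall>\<^sub>F n in sequentially. f n = poly (smult (inverse c) p) (of_nat n)"
    using f unfolding c by (auto elim!: eventually_mono simp: divide_inverse)
  then show ?thesis by (rule that)
qed

text \<open>The case \<alpha> = 1, \<beta> = 0: the solution is a polynomial p. The polynomial p(x)
  - p(x-1) tends to 0 along the integers, so it is zero; this kills every coefficient on the right
  and makes p constant on the integers.\<close>

lemma rational_telescoping_trivial:
  assumes "rational_germ f"
    and eq: "\<forall>\<^sub>F n in sequentially. f n - f (n - 1) = (\<Sum>d=1..J. e d * inverse (of_nat n) ^ d)"
  shows "(\<forall>d. 1 \<le> d \<longrightarrow> d \<le> J \<longrightarrow> e d = 0) \<and> (\<exists>c. \<forall>\<^sub>F n in sequentially. f n = c)"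
proof -
  have eq': "\<forall>\<^sub>F n in sequentially. f n - (1 + 0 / of_nat n) * f (n - 1)
              = (\<Sum>d=1..J. e d * inverse (of_nat n) ^ d)"
    using eq by simp
  obtain p where f: "\<forall>\<^sub>F n in sequentially. f n = poly p (of_nat n)"
    by (rule rational_difference_equation_poly[OF assms(1) _ eq']) (simp del: of_nat_Suc)
  define r where "r = p - pcompose p [:-1, 1:]"
  have r: "\<forall>\<^sub>F n in sequentially. poly r (of_nat n) = (\<Sum>d=1..J. e d * inverse (of_nat n) ^ d)"
    using eq f eventually_pred[OF f] eventually_ge_at_top[of 1]
    by eventually_elim (simp add: r_def poly_pcompose of_nat_diff)
  have "r = 0"
    by (rule poly_eq_0_if_tendsto_0, rule Lim_transform_eventually[OF inverse_power_sum_tendsto_0])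
      (use r in \<open>auto elim: eventually_mono\<close>)
  have "e d = 0" if "1 \<le> d" "d \<le> J" for d
    by (rule inverse_power_sum_coeffs_zero[OF _ that])
      (use r \<open>r = 0\<close> in \<open>auto elim: eventually_mono\<close>)
  moreover have step: "poly p x = poly p (x - 1)" for x
  proof -
    have "poly r x = 0" using \<open>r = 0\<close> by simp
    then show ?thesis by (simp add: r_def poly_pcompose)
  qed
  have "poly p (of_nat n) = poly p 0" for n
    by (induction n) (use step in \<open>metis of_nat_0, metis add_diff_cancel_left' of_nat_Suc\<close>)
  then have "\<exists>c. \<forall>\<^sub>F n in sequentially. f n = c" using f by auto
  ultimately show ?thesis by blast
qed

text \<open>The case \<alpha> = 4, \<beta> = -2, where \<alpha> (m + 1) + \<beta> = 4m + 2 is never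
  0. Division of the equation by n^(degree p) and passage to the limit give c - 4c = 0 for the
  leading coefficient c of the polynomial solution p, so p = 0.\<close>

lemma rational_central_binomial_difference_trivial:
  assumes "rational_germ f"
    and eq: "\<forall>\<^sub>F n in sequentially. f n - (4 - 2 / of_nat n) * f (n - 1)
              = (\<Sum>d=1..J. e d * inverse (of_nat n) ^ d)"
  shows "(\<forall>d. 1 \<le> d \<longrightarrow> d \<le> J \<longrightarrow> e d = 0) \<and> (\<forall>\<^sub>F n in sequentially. f n = 0)"
proof -
  have nz: "4 * of_nat (Suc m) + (-2) \<noteq> (0 :: complex)" for m
  proof -
    have "4 * of_nat (Suc m) + (-2) = (of_nat (4 * m + 2) :: complex)" by simp
    then show ?thesis by (metis add_2_eq_Suc' nat.distinct(1) of_nat_eq_0_iff)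
  qed
  have eq': "\<forall>\<^sub>F n in sequentially. f n - (4 + (-2) / of_nat n) * f (n - 1)
              = (\<Sum>d=1..J. e d * inverse (of_nat n) ^ d)"
    using eq by simp
  obtain p where f: "\<forall>\<^sub>F n in sequentially. f n = poly p (of_nat n)"
    by (rule rational_difference_equation_poly[OF assms(1) nz eq'])
  define p' where "p' = pcompose p [:-1, 1:]"
  have deg: "degree p' = degree p" by (simp add: p'_def degree_pcompose)
  have lc: "lead_coeff p' = lead_coeff p" 
    unfolding p'_def by (subst lead_coeff_comp) auto
  let ?x = "\<lambda>n. inverse (of_nat n :: complex)"
  have L: "(\<lambda>n. poly p (of_nat n) / of_nat n ^ degree p) \<longlonglongrightarrow> lead_coeff p"
    by (rule filterlim_compose[OF poly_divide_tendsto_aux tendsto_of_nat])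
  have L': "(\<lambda>n. poly p' (of_nat n) / of_nat n ^ degree p) \<longlonglongrightarrow> lead_coeff p"
    using filterlim_compose[OF poly_divide_tendsto_aux[of p'] tendsto_of_nat]
    unfolding lc unfolding deg .
  have lim1: "(\<lambda>n. poly p (of_nat n) / of_nat n ^ degree p
           - (4 - 2 * ?x n) * (poly p' (of_nat n) / of_nat n ^ degree p))
        \<longlonglongrightarrow> lead_coeff p - (4 - 2 * 0) * lead_coeff p"
    by (intro tendsto_intros L L' lim_inverse_n)
  have lim2: "(\<lambda>n. (\<Sum>d=1..J. e d * ?x n ^ d) * ?x n ^ degree p) \<longlonglongrightarrow> 0 * 0 ^ degree p"
    by (intro tendsto_intros inverse_power_sum_tendsto_0 lim_inverse_n)
  have "\<forall>\<^sub>F n in sequentially. (\<Sum>d=1..J. e d * ?x n ^ d) * ?x n ^ degree p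
     = poly p (of_nat n) / of_nat n ^ degree p
       - (4 - 2 * ?x n) * (poly p' (of_nat n) / of_nat n ^ degree p)"
    using eq f eventually_pred[OF f] eventually_gt_at_top[of 0]
  proof eventually_elim
    case (elim n)
    have "poly p' (of_nat n) = f (n - 1)"
      using elim by (simp add: p'_def poly_pcompose of_nat_diff)
    with elim(2) show ?case
      unfolding elim(1)[symmetric] by (simp add: divide_inverse power_inverse algebra_simps)
  qed
  from LIMSEQ_unique[OF lim1 Lim_transform_eventually[OF lim2 this]]
  have "lead_coeff p - (4 - 2 * 0) * lead_coeff p = 0 * 0 ^ degree p" .
  then have "p = 0" by simp
  with f have z: "\<forall>\<^sub>F n in sequentially. f n = 0" by simp
  have "\<forall>\<^sub>F n in sequentially. (\<Sum>d=1..J. e d * inverse (of_nat n) ^ d) = 0"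
    using eq z eventually_pred[OF z] by eventually_elim simp
  then show ?thesis using inverse_power_sum_coeffs_zero z by blast
qed

section \<open>Linear independence over the rational functions\<close>

definition rational_independent :: "('b \<Rightarrow> nat \<Rightarrow> complex) \<Rightarrow> 'b set \<Rightarrow> bool" where
  "rational_independent s I \<longleftrightarrow>
     (\<forall>P. (\<forall>i\<in>I. rational_germ (P i)) \<longrightarrow> (\<forall>\<^sub>F n in sequentially. (\<Sum>i\<in>I. P i n * s i n) = 0)
        \<longrightarrow> (\<forall>i\<in>I. \<forall>\<^sub>F n in sequentially. P i n = 0))"

lemma rational_independentD:
  assumes "rational_independent s I" "\<And>i. i \<in> I \<Longrightarrow> rational_germ (P i)"
    "\<forall>\<^sub>F n in sequentially. (\<Sum>i\<in>I. P i n * s i n) = 0" "i \<in> I"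
  shows "\<forall>\<^sub>F n in sequentially. P i n = 0"
  using assms unfolding rational_independent_def by blast

text \<open>The coefficient of x cannot vanish for large n, since otherwise I would itself be
  dependent. It is therefore an invertible germ and the relation can be solved for
  \<open>s x\<close>.\<close>

lemma rational_dependence_insert:
  assumes "finite I" "rational_independent s I" "x \<notin> I" "\<not> rational_independent s (insert x I)"
  obtains P where "\<And>i. i \<in> I \<Longrightarrow> rational_germ (P i)"
    "\<forall>\<^sub>F n in sequentially. s x n = (\<Sum>i\<in>I. P i n * s i n)"
proof -
  from assms(4) obtain P i where P: "\<And>i. i \<in> insert x I \<Longrightarrow> rational_germ (P i)"
    and rel: "\<forall>\<^sub>F n in sequentially. (\<Sum>i\<in>insert x I. P i n * s i n) = 0"
    and i: "i \<in> insert x I" "\<not> (\<forall>\<^sub>F n in sequentially. P i n = 0)"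
    unfolding rational_independent_def by blast
  have rel': "\<forall>\<^sub>F n in sequentially. P x n * s x n + (\<Sum>i\<in>I. P i n * s i n) = 0"
    using rel assms(1,3) by simp
  have "\<not> (\<forall>\<^sub>F n in sequentially. P x n = 0)"
  proof
    assume z: "\<forall>\<^sub>F n in sequentially. P x n = 0"
    have "\<forall>\<^sub>F n in sequentially. (\<Sum>i\<in>I. P i n * s i n) = 0"
      using rel' z by eventually_elim simp
    then have "\<forall>i\<in>I. \<forall>\<^sub>F n in sequentially. P i n = 0"
      using rational_independentD[OF assms(2)] P by blast
    with i z show False by blast
  qed
  then have nz: "\<forall>\<^sub>F n in sequentially. P x n \<noteq> 0"
    using rational_germ_zero_or_nonzero[OF P[of x]] by blast
  show ?thesis
  proof (rule that[of "\<lambda>i n. - (inverse (P x n) * P i n)"])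
    show "rational_germ (\<lambda>n. - (inverse (P x n) * P i n))" if "i \<in> I" for i
      using that by (intro rational_germ_uminus rational_germ_mult rational_germ_inverse P) auto
    show "\<forall>\<^sub>F n in sequentially. s x n = (\<Sum>i\<in>I. - (inverse (P x n) * P i n) * s i n)"
      using rel' nz
    proof eventually_elim
      case (elim n)
      have "(\<Sum>i\<in>I. - (inverse (P x n) * P i n) * s i n) = - inverse (P x n) * (\<Sum>i\<in>I. P i n * s i n)"
        unfolding sum_distrib_left by (intro sum.cong) auto
      also have "(\<Sum>i\<in>I. P i n * s i n) = - (P x n * s x n)"
        using elim by (simp add: eq_neg_iff_add_eq_0 add.commute)
      finally show ?case using elim by simp
    qed
  qed
qed

text \<open>Shifting a relation \<open>s x = \<Sum> P i * s i\<close> and comparing coefficients gives a first order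
  difference equation for each \<open>P i\<close>, whose inhomogeneous part only involves the \<open>P z\<close> of larger
  weight. By descending induction on the weight all of them are constant.\<close>

lemma rational_dependence_imp_constant_dependence:
  fixes s :: "'b \<Rightarrow> nat \<Rightarrow> complex" and wt :: "'b \<Rightarrow> nat" and u :: "'b \<Rightarrow> 'b \<Rightarrow> complex"
  assumes I: "finite I" "rational_independent s I"
    and wt: "\<And>i. i \<in> I \<Longrightarrow> wt i \<le> wt x" "wt x > 0"
    and rec: "\<And>z. z \<in> insert x I \<Longrightarrow> wt z > 0 \<Longrightarrow> \<forall>\<^sub>F n in sequentially.
        s z (n - 1) = s z n + (\<Sum>i\<in>I. u z i * inverse (of_nat n) ^ (wt z - wt i) * s i n)"
    and u: "\<And>z i. wt z \<le> wt i \<Longrightarrow> u z i = 0"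
    and zero: "\<And>z. z \<in> I \<Longrightarrow> wt z = 0 \<Longrightarrow>
        \<forall>\<^sub>F n in sequentially. s z (n - 1) = (4 - 2 / of_nat n) * s z n"
    and lim: "\<And>z. z \<in> insert x I \<Longrightarrow> s z \<longlonglongrightarrow> 0"
    and P: "\<And>i. i \<in> I \<Longrightarrow> rational_germ (P i)"
    and dep: "\<forall>\<^sub>F n in sequentially. s x n = (\<Sum>i\<in>I. P i n * s i n)"
  obtains c where "\<forall>\<^sub>F n in sequentially. s x n = (\<Sum>i\<in>{i\<in>I. wt i = wt x}. c i * s i n)"
proof -
  \<comment> \<open>The factor of \<open>s i n\<close> in the recursion for
    \<open>s i (n - 1)\<close>: with it, weight 0 and positive weights obey a recursion of one
    common shape.\<close>
  define g where "g i = (\<lambda>n::nat. if wt i = 0 then 4 - 2 / of_nat n else 1 :: complex)" for i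
  have g_germ: "rational_germ (g i)" for i
  proof (cases "wt i = 0")
    case True
    have "rational_germ (\<lambda>n. 4 - 2 * inverse (of_nat n) ^ 1)"
      by (intro rational_germ_diff rational_germ_mult rational_germ_const
          rational_germ_inverse_power)
    with True show ?thesis unfolding g_def by (simp add: divide_inverse)
  qed (simp add: g_def rational_germ_const)
  have rec': "\<forall>\<^sub>F n in sequentially. s z (n - 1)
      = g z n * s z n + (\<Sum>i\<in>I. u z i * inverse (of_nat n) ^ (wt z - wt i) * s i n)"
    if "z \<in> I" for z
  proof (cases "wt z = 0")
    case True
    then have "u z i = 0" for i by (intro u) simp
    with zero[OF that True] True show ?thesis by (simp add: g_def)
  next
    case False
    with rec[of z] that show ?thesis by (simp add: g_def)
  qed
  have all_rec: "\<forall>\<^sub>F n in sequentially. \<forall>z\<in>I. s z (n - 1)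
      = g z n * s z n + (\<Sum>i\<in>I. u z i * inverse (of_nat n) ^ (wt z - wt i) * s i n)"
    using rec' by (intro eventually_ball_finite I(1)) blast
  \<comment> \<open>Two expressions for \<open>s x (n - 1)\<close> in terms of the
    \<open>s i n\<close> are compared: the recursion of x with the relation at n inserted, and the
    relation at n - 1 with the recursions of its members inserted. Independence makes the difference
    vanish coefficientwise.\<close>
  have coeff: "\<forall>\<^sub>F n in sequentially. P i n + u x i * inverse (of_nat n) ^ (wt x - wt i)
      - P i (n - 1) * g i n
      - (\<Sum>z\<in>I. P z (n - 1) * (u z i * inverse (of_nat n) ^ (wt z - wt i))) = 0"
    if "i \<in> I" for i
  proof (rule rational_independentD[OF I(2) _ _ that])
    show "rational_germ (\<lambda>n. P i n + u x i * inverse (of_nat n) ^ (wt x - wt i) - P i (n - 1) * g i n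
      - (\<Sum>z\<in>I. P z (n - 1) * (u z i * inverse (of_nat n) ^ (wt z - wt i))))" if "i \<in> I" for i
    proof -
      have pred: "rational_germ (\<lambda>n. P z (n - 1))" if "z \<in> I" for z
        by (rule rational_germ_pred[OF P[OF that]])
      show ?thesis
        by (intro rational_germ_diff rational_germ_add rational_germ_mult rational_germ_sum
            P[OF that] pred[OF that] pred g_germ rational_germ_const rational_germ_inverse_power)
    qed
    show "\<forall>\<^sub>F n in sequentially. (\<Sum>i\<in>I. (P i n + u x i * inverse (of_nat n) ^ (wt x - wt i)
      - P i (n - 1) * g i n
      - (\<Sum>z\<in>I. P z (n - 1) * (u z i * inverse (of_nat n) ^ (wt z - wt i)))) * s i n) = 0"
      using dep eventually_pred[OF dep] all_rec rec[OF insertI1 wt(2)]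
    proof eventually_elim
      case (elim n)
      have "(\<Sum>i\<in>I. (\<Sum>z\<in>I. P z (n - 1) * (u z i * inverse (of_nat n) ^ (wt z - wt i))) * s i n)
        = (\<Sum>z\<in>I. P z (n - 1) * (\<Sum>i\<in>I. u z i * inverse (of_nat n) ^ (wt z - wt i) * s i n))"
        unfolding sum_distrib_left sum_distrib_right
        by (subst sum.swap) (simp add: mult_ac)
      then have "(\<Sum>i\<in>I. (P i (n - 1) * g i n) * s i n)
        + (\<Sum>i\<in>I. (\<Sum>z\<in>I. P z (n - 1) * (u z i * inverse (of_nat n) ^ (wt z - wt i))) * s i n)
        = (\<Sum>z\<in>I. P z (n - 1) * s z (n - 1))"
        using elim(3) by (simp add: sum.distrib[symmetric] algebra_simps)
      also have "\<dots> = s x (n - 1)" using elim by simp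
      also have "\<dots> = (\<Sum>i\<in>I. P i n * s i n)
          + (\<Sum>i\<in>I. u x i * inverse (of_nat n) ^ (wt x - wt i) * s i n)"
        using elim by simp
      finally show ?case
        by (simp add: sum.distrib sum_subtractf left_diff_distrib distrib_right)
          (simp add: algebra_simps)
    qed
  qed
  \<comment> \<open>Once the \<open>P z\<close> of weight above \<open>wt i\<close> are constants
    \<open>p z\<close>, collecting powers of 1/n turns \<open>coeff\<close> into a difference
    equation for \<open>P i\<close> alone. The z with wt z = wt i + d contribute to n^(-d), and the
    recursion of x contributes at d = wt x - wt i. The vanishing of these coefficients is recorded
    for use in \<open>top\<close>.\<close>
  have step: "(\<forall>d. 1 \<le> d \<longrightarrow> d \<le> wt x \<longrightarrow>
        (\<Sum>z\<in>{z\<in>I. wt z = wt i + d}. p z * u z i) - (if d = wt x - wt i then u x i else 0) = 0)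
      \<and> (\<exists>c. \<forall>\<^sub>F n in sequentially. P i n = c)"
    if i: "i \<in> I" and p: "\<And>z. z \<in> I \<Longrightarrow> wt i < wt z \<Longrightarrow> \<forall>\<^sub>F n in sequentially. P z n = p z"
    for i p
  proof -
    define e where "e d = (\<Sum>z\<in>{z\<in>I. wt z = wt i + d}. p z * u z i)
        - (if d = wt x - wt i then u x i else 0)" for d
    have "\<forall>\<^sub>F n in sequentially. \<forall>z\<in>{z\<in>I. wt i < wt z}. P z (n - 1) = p z"
      using eventually_pred[OF p] I(1) by (intro eventually_ball_finite) auto
    then have "\<forall>\<^sub>F n in sequentially. P i n - g i n * P i (n - 1)
        = (\<Sum>d=1..wt x. e d * inverse (of_nat n) ^ d)"
      using coeff[OF i]
    proof eventually_elim
      case (elim n)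
      let ?v = "inverse (of_nat n :: complex)"
      have "(\<Sum>z\<in>I. P z (n - 1) * (u z i * ?v ^ (wt z - wt i)))
          = (\<Sum>z\<in>{z\<in>I. wt i < wt z}. P z (n - 1) * (u z i * ?v ^ (wt z - wt i)))"
        using I(1) u by (intro sum.mono_neutral_right) (auto simp: not_less)
      also have "\<dots> = (\<Sum>z\<in>{z\<in>I. wt i < wt z}. p z * u z i * ?v ^ (wt z - wt i))"
        using elim by (intro sum.cong) auto
      also have "\<dots> = (\<Sum>d=1..wt x. \<Sum>z\<in>{z\<in>{z\<in>I. wt i < wt z}. wt z - wt i = d}.
          p z * u z i * ?v ^ (wt z - wt i))"
        using I(1)
        by (intro sum.group[symmetric])
          (auto simp: le_diff_conv Suc_le_eq intro!: trans_le_add1 wt(1))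
      also have "\<dots> = (\<Sum>d=1..wt x. (\<Sum>z\<in>{z\<in>I. wt z = wt i + d}. p z * u z i) * ?v ^ d)"
        unfolding sum_distrib_right by (intro sum.cong) auto
      finally have 1: "(\<Sum>z\<in>I. P z (n - 1) * (u z i * ?v ^ (wt z - wt i)))
        = (\<Sum>d=1..wt x. (\<Sum>z\<in>{z\<in>I. wt z = wt i + d}. p z * u z i) * ?v ^ d)" .
      have 2: "(\<Sum>d=1..wt x. (if d = wt x - wt i then u x i else 0) * ?v ^ d)
          = u x i * ?v ^ (wt x - wt i)"
      proof (cases "wt x - wt i = 0")
        case True
        \<comment> \<open>The exponent 0 lies outside the range 1..wt x, but in this case there is
          no contribution of x to place.\<close>
        then have "u x i = 0" by (intro u) simp
        then show ?thesis by (simp cong: if_cong)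
      next
        case False
        have "(\<Sum>d=1..wt x. (if d = wt x - wt i then u x i else 0) * ?v ^ d)
           = (\<Sum>d=1..wt x. if d = wt x - wt i then u x i * ?v ^ d else 0)"
          by (intro sum.cong) auto
        also have "\<dots> = u x i * ?v ^ (wt x - wt i)"
          using False by (subst sum.delta) auto
        finally show ?thesis .
      qed
      have "(\<Sum>d=1..wt x. e d * ?v ^ d) = (\<Sum>z\<in>I. P z (n - 1) * (u z i * ?v ^ (wt z - wt i)))
          - u x i * ?v ^ (wt x - wt i)"
        unfolding 1 2[symmetric] e_def left_diff_distrib sum_subtractf ..
      moreover have "p - g' * q = E" if "p + U - q * g' - S = 0" "E = S - U"
        for p U q g' S E :: complex
        using that by algebra
      ultimately show ?case using elim(2) by blast
    qed
    then have "(\<forall>d. 1 \<le> d \<longrightarrow> d \<le> wt x \<longrightarrow> e d = 0) \<and> (\<exists>c. \<forall>\<^sub>F n in sequentially. P i n = c)"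
      using rational_telescoping_trivial[OF P[OF i]]
        rational_central_binomial_difference_trivial[OF P[OF i]]
      unfolding g_def by (cases "wt i = 0") (simp_all, blast+)
    then show ?thesis unfolding e_def .
  qed
  have const: "\<exists>c. \<forall>\<^sub>F n in sequentially. P i n = c" if "i \<in> I" for i
    using that
  proof (induction "wt x - wt i" arbitrary: i rule: less_induct)
    case less
    have "\<exists>c. \<forall>\<^sub>F n in sequentially. P z n = c" if "z \<in> I" "wt i < wt z" for z
      using that wt(1)[OF that(1)] by (intro less.hyps) auto
    then obtain p where "\<And>z. z \<in> I \<Longrightarrow> wt i < wt z \<Longrightarrow> \<forall>\<^sub>F n in sequentially. P z n = p z"
      by metis
    from step[OF less.prems this] show ?case by blast
  qed
  then obtain p where p: "\<And>z. z \<in> I \<Longrightarrow> \<forall>\<^sub>F n in sequentially. P z n = p z" by metis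
  let ?J = "{i\<in>I. wt i = wt x}"
  \<comment> \<open>For i of weight below that of x this is the coefficient at d = wt x - wt i in
    \<open>step\<close>. It says that the combination of the \<open>s z\<close> of weight
    \<open>wt x\<close> with constants \<open>p z\<close> obeys the same recursion as
    \<open>s x\<close>.\<close>
  have top: "(\<Sum>z\<in>?J. p z * u z i) = u x i" if "i \<in> I" for i
  proof (cases "wt i < wt x")
    case True
    have above: "\<forall>\<^sub>F n in sequentially. P z n = p z" if "z \<in> I" "wt i < wt z" for z
      using p[OF that(1)] .
    have "(\<Sum>z\<in>{z\<in>I. wt z = wt i + (wt x - wt i)}. p z * u z i)
        - (if wt x - wt i = wt x - wt i then u x i else 0) = 0"
      using True by (intro step[OF that above, THEN conjunct1, rule_format]) auto
    with True show ?thesis by simp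
  next
    case False
    then show ?thesis by (simp add: u)
  qed
  \<comment> \<open>Only the part of the relation in the weight of x is kept. By \<open>top\<close>
    the inhomogeneous terms cancel in h, so h is eventually constant, and its limit 0 determines the
    constant.\<close>
  define h where "h n = s x n - (\<Sum>z\<in>?J. p z * s z n)" for n
  have "\<forall>\<^sub>F n in sequentially. h n = h (n - 1)"
    using all_rec rec[OF insertI1 wt(2)]
  proof eventually_elim
    case (elim n)
    let ?v = "inverse (of_nat n :: complex)"
    have "(\<Sum>z\<in>?J. p z * s z (n - 1))
      = (\<Sum>z\<in>?J. p z * (s z n + (\<Sum>i\<in>I. u z i * ?v ^ (wt z - wt i) * s i n)))"
      using elim(1) wt(2) by (intro sum.cong) (auto simp: g_def)
    also have "\<dots> = (\<Sum>z\<in>?J. p z * s z n)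
        + (\<Sum>z\<in>?J. \<Sum>i\<in>I. p z * u z i * ?v ^ (wt x - wt i) * s i n)"
      unfolding distrib_left sum.distrib sum_distrib_left
      by (intro arg_cong2[where f = "(+)"] sum.cong refl) auto
    also have "(\<Sum>z\<in>?J. \<Sum>i\<in>I. p z * u z i * ?v ^ (wt x - wt i) * s i n)
        = (\<Sum>i\<in>I. (\<Sum>z\<in>?J. p z * u z i) * ?v ^ (wt x - wt i) * s i n)"
      by (subst sum.swap) (simp add: sum_distrib_right)
    also have "\<dots> = (\<Sum>i\<in>I. u x i * ?v ^ (wt x - wt i) * s i n)"
      using top by (intro sum.cong) auto
    finally show ?case unfolding h_def using elim(2) by simp
  qed
  then obtain N where N: "\<And>n. n \<ge> N \<Longrightarrow> h n = h (n - 1)"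
    unfolding eventually_sequentially by blast
  have hN: "h n = h N" if "n \<ge> N" for n
    using that
  proof (induction n rule: dec_induct)
    case (step n)
    with N[of "Suc n"] show ?case by simp
  qed simp
  have "h \<longlonglongrightarrow> 0 - (\<Sum>z\<in>?J. p z * 0)"
    unfolding h_def by (intro tendsto_intros lim) auto
  moreover have "h \<longlonglongrightarrow> h N"
    by (rule tendsto_eventually, unfold eventually_sequentially, intro exI[of _ N] allI impI hN)
  ultimately have "h N = 0 - (\<Sum>z\<in>?J. p z * 0)" by (rule LIMSEQ_unique[rotated])
  then have "h n = 0" if "n \<ge> N" for n using hN[OF that] by simp
  then have "\<forall>\<^sub>F n in sequentially. s x n = (\<Sum>i\<in>?J. p i * s i n)"
    unfolding eventually_sequentially by (intro exI[of _ N]) (simp add: h_def)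
  then show ?thesis by (rule that)
qed

text \<open>Elements are inserted in order of weight. A new x that is independent of I over the
  germs joins I. Otherwise the recursions, rewritten in terms of I, satisfy the assumptions of
  \<open>rational_dependence_imp_constant_dependence\<close>, which expresses x by members of I of
  its own weight; then I is kept.\<close>

lemma graded_rational_basis:
  fixes s :: "'b \<Rightarrow> nat \<Rightarrow> complex" and wt :: "'b \<Rightarrow> nat" and a :: "'b \<Rightarrow> 'b \<Rightarrow> complex"
  assumes "finite X"
    and "\<And>b. b \<in> X \<Longrightarrow> wt b > 0 \<Longrightarrow> \<forall>\<^sub>F n in sequentially. s b (n - 1)
      = s b n + (\<Sum>y\<in>{y\<in>X. wt y < wt b}. a b y * inverse (of_nat n) ^ (wt b - wt y) * s y n)"
    and "\<And>b. b \<in> X \<Longrightarrow> wt b = 0 \<Longrightarrow>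
      \<forall>\<^sub>F n in sequentially. s b (n - 1) = (4 - 2 / of_nat n) * s b n \<and> s b n \<noteq> 0"
    and "\<And>b b'. b \<in> X \<Longrightarrow> b' \<in> X \<Longrightarrow> wt b = 0 \<Longrightarrow> wt b' = 0 \<Longrightarrow> b = b'"
    and "\<And>b. b \<in> X \<Longrightarrow> s b \<longlonglongrightarrow> 0"
  shows "\<exists>I\<subseteq>X. rational_independent s I \<and>
    (\<forall>b\<in>X. \<exists>c. \<forall>\<^sub>F n in sequentially. s b n = (\<Sum>i\<in>{i\<in>I. wt i = wt b}. c i * s i n))"
  using assms
proof (induction X rule: finite_ranking_induct[where f = wt])
  case empty
  show ?case by (auto simp: rational_independent_def)
next
  case (insert x S)
  note rec = insert.prems(1) and zero = insert.prems(2) and uniq = insert.prems(3)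
    and lim = insert.prems(4)
  show ?case
  proof (cases "x \<in> S")
    case True
    then have eq: "insert x S = S" by blast
    show ?thesis unfolding eq by (rule insert.IH[OF insert.prems[unfolded eq]])
  next
    case xS: False
    \<comment> \<open>The weight of x is maximal so far, so x never occurs in the recursion of
      another element or of itself.\<close>
    have low: "{y \<in> insert x S. wt y < wt b} = {y \<in> S. wt y < wt b}" if "b \<in> insert x S" for b
      using that insert.hyps(2) by (auto simp: not_less dest: leD)
    have "\<exists>I\<subseteq>S. rational_independent s I \<and>
      (\<forall>b\<in>S. \<exists>c. \<forall>\<^sub>F n in sequentially. s b n = (\<Sum>i\<in>{i\<in>I. wt i = wt b}. c i * s i n))"
    proof (rule insert.IH)
      show "\<forall>\<^sub>F n in sequentially. s b (n - 1)
        = s b n + (\<Sum>y\<in>{y\<in>S. wt y < wt b}. a b y * inverse (of_nat n) ^ (wt b - wt y) * s y n)"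
        if "b \<in> S" "wt b > 0" for b
        using rec[of b] low[of b] that by simp
    qed (use zero uniq lim in auto)
    then obtain I where I: "I \<subseteq> S" "rational_independent s I"
      and "\<forall>b\<in>S. \<exists>c. \<forall>\<^sub>F n in sequentially. s b n = (\<Sum>i\<in>{i\<in>I. wt i = wt b}. c i * s i n)"
      by blast
    from bchoice[OF this(3)] obtain c where c: "\<And>b. b \<in> S \<Longrightarrow>
        \<forall>\<^sub>F n in sequentially. s b n = (\<Sum>i\<in>{i\<in>I. wt i = wt b}. c b i * s i n)"
      by blast
    have "finite I" using I(1) insert.hyps(1) finite_subset by blast
    show ?thesis
    proof (cases "rational_independent s (insert x I)")
      case True
      have x_comb: "s x n = (\<Sum>i\<in>{i\<in>insert x I. wt i = wt x}. (if i = x then 1 else 0) * s i n)" for n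
      proof -
        have "(\<Sum>i\<in>{i\<in>insert x I. wt i = wt x}. (if i = x then 1 else 0) * s i n)
          = (\<Sum>i\<in>{i\<in>insert x I. wt i = wt x}. if i = x then s i n else 0)"
          by (intro sum.cong) auto
        also have "\<dots> = s x n" using \<open>finite I\<close> by (subst sum.delta) auto
        finally show ?thesis by simp
      qed
      have b_comb: "\<forall>\<^sub>F n in sequentially.
          s b n = (\<Sum>i\<in>{i\<in>insert x I. wt i = wt b}. (if i = x then 0 else c b i) * s i n)"
        if "b \<in> S" for b
        using c[OF that]
      proof eventually_elim
        case (elim n)
        have "x \<notin> I" using xS I(1) by blast
        have "(\<Sum>i\<in>{i\<in>I. wt i = wt b}. c b i * s i n)
          = (\<Sum>i\<in>{i\<in>insert x I. wt i = wt b}. (if i = x then 0 else c b i) * s i n)"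
          using \<open>finite I\<close> \<open>x \<notin> I\<close> by (intro sum.mono_neutral_cong_left) auto
        with elim show ?case by simp
      qed
      show ?thesis
      proof (intro exI[of _ "insert x I"] conjI ballI)
        fix b assume "b \<in> insert x S"
        then show "\<exists>c. \<forall>\<^sub>F n in sequentially.
            s b n = (\<Sum>i\<in>{i\<in>insert x I. wt i = wt b}. c i * s i n)"
        proof
          assume "b = x"
          then show ?thesis
            using x_comb by (intro exI[of _ "\<lambda>i. if i = x then 1 else 0"] always_eventually allI) simp
        next
          assume "b \<in> S"
          from b_comb[OF this] show ?thesis by (rule exI[of _ "\<lambda>i. if i = x then 0 else c b i"])
        qed
      qed (use True I in auto)
    next
      case dependent: False
      \<comment> \<open>If x had weight 0, it would by uniqueness be the only element so far, and a
        sequence without zeros at large n is independent by itself.\<close>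
      have "wt x > 0"
      proof (rule ccontr)
        assume "\<not> wt x > 0"
        then have "wt x = 0" by simp
        then have "wt y = 0" if "y \<in> S" for y
          using insert.hyps(2) that by force
        then have "S = {}" using uniq[of x] \<open>wt x = 0\<close> xS by auto
        then have "I = {}" using I(1) by simp
        have "rational_independent s {x}"
          unfolding rational_independent_def
        proof (intro allI impI ballI)
          fix P i assume rel: "\<forall>\<^sub>F n in sequentially. (\<Sum>i\<in>{x}. P i n * s i n) = 0" and "i \<in> {x}"
          show "\<forall>\<^sub>F n in sequentially. P i n = 0"
            using zero[OF insertI1 \<open>wt x = 0\<close>] rel
            by eventually_elim (use \<open>i \<in> {x}\<close> in auto)
        qed
        with dependent \<open>I = {}\<close> show False by simp
      qed
      have "x \<notin> I" using xS I(1) by blast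
      from rational_dependence_insert[OF \<open>finite I\<close> I(2) this dependent]
      obtain P where P: "\<And>i. i \<in> I \<Longrightarrow> rational_germ (P i)"
        "\<forall>\<^sub>F n in sequentially. s x n = (\<Sum>i\<in>I. P i n * s i n)" by blast
      \<comment> \<open>Each y of lower weight in the recursion is replaced by its expansion in I.
        That expansion stays within the weight of y, so the exponents of 1/n are unchanged.\<close>
      define u where "u z i = (if wt i < wt z then \<Sum>y\<in>{y\<in>S. wt y = wt i}. a z y * c y i else 0)"
        for z i
      have all_c: "\<forall>\<^sub>F n in sequentially. \<forall>b\<in>S. s b n = (\<Sum>i\<in>{i\<in>I. wt i = wt b}. c b i * s i n)"
        using c by (intro eventually_ball_finite insert.hyps) auto
      have rec': "\<forall>\<^sub>F n in sequentially.
        s z (n - 1) = s z n + (\<Sum>i\<in>I. u z i * inverse (of_nat n) ^ (wt z - wt i) * s i n)"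
        if "z \<in> insert x I" "wt z > 0" for z
      proof -
        have z: "z \<in> insert x S" using that I(1) by blast
        show ?thesis using rec[OF z that(2)] all_c
        proof eventually_elim
          case (elim n)
          let ?v = "inverse (of_nat n :: complex)"
          let ?T = "{y\<in>S. wt y < wt z}"
          have "(\<Sum>y\<in>?T. a z y * ?v ^ (wt z - wt y) * s y n)
            = (\<Sum>y\<in>?T. \<Sum>i\<in>{i\<in>I. wt i = wt y}. a z y * c y i * ?v ^ (wt z - wt i) * s i n)"
            using elim(2) by (intro sum.cong) (auto simp: sum_distrib_left intro!: sum.cong)
          also have "\<dots> = (\<Sum>y\<in>?T. \<Sum>i\<in>I. if wt i = wt y
              then a z y * c y i * ?v ^ (wt z - wt i) * s i n else 0)"
            using \<open>finite I\<close> by (intro sum.cong refl sum.mono_neutral_cong_left) auto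
          also have "\<dots> = (\<Sum>i\<in>I. \<Sum>y\<in>?T. if wt i = wt y
              then a z y * c y i * ?v ^ (wt z - wt i) * s i n else 0)"
            by (rule sum.swap)
          also have "\<dots> = (\<Sum>i\<in>I. u z i * ?v ^ (wt z - wt i) * s i n)"
          proof (intro sum.cong refl)
            fix i
            have "(\<Sum>y\<in>?T. if wt i = wt y then a z y * c y i * ?v ^ (wt z - wt i) * s i n else 0)
              = (\<Sum>y\<in>{y\<in>?T. wt i = wt y}. a z y * c y i * ?v ^ (wt z - wt i) * s i n)"
              using insert.hyps(1) by (intro sum.mono_neutral_cong_right) auto
            also have "\<dots> = (\<Sum>y\<in>{y\<in>?T. wt i = wt y}. a z y * c y i) * ?v ^ (wt z - wt i) * s i n"
              by (simp add: sum_distrib_right)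
            also have "(\<Sum>y\<in>{y\<in>?T. wt i = wt y}. a z y * c y i) = u z i"
              unfolding u_def by (auto intro!: sum.cong sum.neutral)
            finally show "(\<Sum>y\<in>?T. if wt i = wt y
                then a z y * c y i * ?v ^ (wt z - wt i) * s i n else 0)
              = u z i * ?v ^ (wt z - wt i) * s i n" .
          qed
          finally show ?case using elim(1) unfolding low[OF z] by simp
        qed
      qed
      obtain d where d: "\<forall>\<^sub>F n in sequentially. s x n = (\<Sum>i\<in>{i\<in>I. wt i = wt x}. d i * s i n)"
      proof (rule rational_dependence_imp_constant_dependence[OF \<open>finite I\<close> I(2) _ \<open>wt x > 0\<close> rec' _ _ _ P])
        show "wt i \<le> wt x" if "i \<in> I" for i using that I(1) insert.hyps(2) by blast
        show "u z i = 0" if "wt z \<le> wt i" for z i using that by (simp add: u_def)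
        show "\<forall>\<^sub>F n in sequentially. s z (n - 1) = (4 - 2 / of_nat n) * s z n"
          if "z \<in> I" "wt z = 0" for z
        proof -
          have "\<forall>\<^sub>F n in sequentially. s z (n - 1) = (4 - 2 / of_nat n) * s z n \<and> s z n \<noteq> 0"
            using zero[of z] that I(1) by blast
          then show ?thesis by eventually_elim simp
        qed
        show "s z \<longlonglongrightarrow> 0" if "z \<in> insert x I" for z
          using lim that I(1) by blast
      qed
      show ?thesis
        by (rule exI[of _ I]) (use I d c in auto)
    qed
  qed
qed

text \<open>Expanding every \<open>s b\<close> in members of I of the same weight preserves the
  power of n in front of it. Independence then kills each coefficient E_i n^(-(k - wt i)), hence the
  constant E_i, and the part of weight j is a combination of the \<open>s i\<close> with these same
  constants.\<close>

lemma graded_components_vanish: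
  fixes s :: "'b \<Rightarrow> nat \<Rightarrow> complex" and wt :: "'b \<Rightarrow> nat" and e :: "'b \<Rightarrow> complex"
  assumes "finite X" "I \<subseteq> X" "rational_independent s I"
    and comb: "\<forall>b\<in>X. \<exists>c. \<forall>\<^sub>F n in sequentially. s b n = (\<Sum>i\<in>{i\<in>I. wt i = wt b}. c i * s i n)"
    and rel: "\<forall>\<^sub>F n in sequentially. (\<Sum>b\<in>X. e b * inverse (of_nat n) ^ (k - wt b) * s b n) = 0"
  shows "\<forall>\<^sub>F n in sequentially. (\<Sum>b\<in>{b\<in>X. wt b = j}. e b * s b n) = 0"
proof -
  have "finite I" using assms finite_subset by blast
  from bchoice[OF comb] obtain c where c: "\<And>b. b \<in> X \<Longrightarrow>
      \<forall>\<^sub>F n in sequentially. s b n = (\<Sum>i\<in>{i\<in>I. wt i = wt b}. c b i * s i n)" by blast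
  then have all_c: "\<forall>\<^sub>F n in sequentially. \<forall>b\<in>X. s b n = (\<Sum>i\<in>{i\<in>I. wt i = wt b}. c b i * s i n)"
    by (intro eventually_ball_finite assms(1)) auto
  define E where "E i = (\<Sum>b\<in>{b\<in>X. wt b = wt i}. e b * c b i)" for i
  \<comment> \<open>Needed for all of X with the powers of n as weights, and for a single weight
    with factor 1. Y has to be cut out by a condition on weights, because E collects all elements of
    X of a given weight.\<close>
  have regroup: "(\<Sum>b\<in>Y. e b * w (wt b) * s b n) = (\<Sum>i\<in>I. if wt i \<in> wt ` Y then E i * w (wt i) * s i n else 0)"
    if "\<forall>b\<in>X. s b n = (\<Sum>i\<in>{i\<in>I. wt i = wt b}. c b i * s i n)"
      "Y = {b\<in>X. wt b \<in> D}" for Y w n D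
  proof -
    have "(\<Sum>b\<in>Y. e b * w (wt b) * s b n)
        = (\<Sum>b\<in>Y. \<Sum>i\<in>{i\<in>I. wt i = wt b}. e b * c b i * w (wt i) * s i n)"
      using that by (intro sum.cong) (auto simp: sum_distrib_left intro!: sum.cong)
    also have "\<dots> = (\<Sum>b\<in>Y. \<Sum>i\<in>I. if wt i = wt b then e b * c b i * w (wt i) * s i n else 0)"
      using \<open>finite I\<close> by (intro sum.cong refl sum.mono_neutral_cong_left) auto
    also have "\<dots> = (\<Sum>i\<in>I. \<Sum>b\<in>Y. if wt i = wt b then e b * c b i * w (wt i) * s i n else 0)"
      by (rule sum.swap)
    also have "\<dots> = (\<Sum>i\<in>I. if wt i \<in> wt ` Y then E i * w (wt i) * s i n else 0)"
    proof (intro sum.cong refl)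
      fix i
      have "(\<Sum>b\<in>Y. if wt i = wt b then e b * c b i * w (wt i) * s i n else 0)
         = (\<Sum>b\<in>{b\<in>Y. wt b = wt i}. e b * c b i * w (wt i) * s i n)"
        using assms(1) that by (intro sum.mono_neutral_cong_right) auto
      also have "\<dots> = (if wt i \<in> wt ` Y then E i * w (wt i) * s i n else 0)"
      proof (cases "wt i \<in> wt ` Y")
        case True
        then have "{b\<in>Y. wt b = wt i} = {b\<in>X. wt b = wt i}" using that(2) by auto
        with True show ?thesis by (simp add: E_def sum_distrib_right)
      next
        case False
        then have "{b\<in>Y. wt b = wt i} = {}" by (auto simp: image_iff)
        then show ?thesis using False by (simp only: sum.empty if_False)
      qed
      finally show "(\<Sum>b\<in>Y. if wt i = wt b then e b * c b i * w (wt i) * s i n else 0)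
        = (if wt i \<in> wt ` Y then E i * w (wt i) * s i n else 0)" .
    qed
    finally show ?thesis .
  qed
  have "\<forall>\<^sub>F n in sequentially. (\<Sum>i\<in>I. (E i * inverse (of_nat n) ^ (k - wt i)) * s i n) = 0"
    using rel all_c
  proof eventually_elim
    case (elim n)
    show ?case
      using elim(1) regroup[OF elim(2), of X UNIV "\<lambda>d. inverse (of_nat n) ^ (k - d)"] assms(2)
      by (auto intro!: sum.cong elim: trans[rotated] simp: subset_iff)
  qed
  then have ev: "\<forall>\<^sub>F n in sequentially. E i * inverse (of_nat n) ^ (k - wt i) = 0" if "i \<in> I" for i
    by (rule rational_independentD[OF assms(3) _ _ that, rotated])
      (intro rational_germ_mult rational_germ_const rational_germ_inverse_power)
  have E: "E i = 0" if "i \<in> I" for i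
  proof -
    have "\<forall>\<^sub>F n::nat in sequentially. E i = 0"
      using ev[OF that] eventually_gt_at_top[of 0] by eventually_elim simp
    then show ?thesis by simp
  qed
  show ?thesis using all_c
  proof eventually_elim
    case (elim n)
    have "{b\<in>X. wt b = j} = {b\<in>X. wt b \<in> {j}}" by simp
    from regroup[OF elim this, of "\<lambda>_. 1"] show ?case
      using E by (simp cong: if_cong)
  qed
qed

section \<open>Words and duality of compositions\<close>

lemma comp_word_Nil [simp]: "comp_word [] = []"
  by (simp add: comp_word_def)

lemma comp_word_Cons [simp]:
  "comp_word (x # a) = replicate (x - 1) False @ True # comp_word a"
  by (simp add: comp_word_def)

lemma comp_word_append [simp]: "comp_word (a @ b) = comp_word a @ comp_word b"
  by (simp add: comp_word_def)

lemma dual_word_dual_word [simp]: "dual_word (dual_word w) = w"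
  by (simp add: dual_word_def rev_map comp_def)

lemma length_comp_word: "a \<in> compositions \<Longrightarrow> length (comp_word a) = weight a"
  by (induction a) (auto simp: compositions_def weight_def)

lemma replicate_False_True_eq:
  "replicate i False @ True # u = replicate j False @ True # v \<longleftrightarrow> i = j \<and> u = v"
proof (induction i arbitrary: j)
  case 0
  then show ?case by (cases j) auto
next
  case (Suc i)
  then show ?case by (cases j) auto
qed

lemma comp_word_inject:
  assumes "a \<in> compositions" "b \<in> compositions" "comp_word a = comp_word b"
  shows "a = b"
  using assms
proof (induction a arbitrary: b)
  case Nil
  then show ?case by (cases b) auto
next
  case (Cons x a)
  then obtain y b' where b: "b = y # b'" by (cases b) auto
  have pos: "0 < x" "0 < y" "a \<in> compositions" "b' \<in> compositions"
    using Cons.prems b by (auto simp: compositions_def)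
  have "x - 1 = y - 1" "comp_word a = comp_word b'"
    using Cons.prems(3) unfolding b by (simp_all add: replicate_False_True_eq)
  with pos Cons.IH[of b'] show ?case unfolding b by simp
qed

lemma comp_word_surj:
  assumes "w = [] \<or> last w"
  obtains a where "a \<in> compositions" "comp_word a = w"
proof -
  have "\<exists>a \<in> compositions. comp_word a = w"
    using assms
  proof (induction w)
    case Nil
    show ?case by (intro bexI[of _ "[]"]) (auto simp: compositions_def)
  next
    case (Cons l w)
    show ?case
    proof (cases "w = []")
      case True
      with Cons.prems show ?thesis
        by (intro bexI[of _ "[1]"]) (auto simp: compositions_def)
    next
      case False
      with Cons obtain a where a: "a \<in> compositions" "comp_word a = w" by auto
      show ?thesis
      proof (cases l)
        case True
        with a show ?thesis
          by (intro bexI[of _ "1 # a"]) (auto simp: compositions_def)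
      next
        case l: False
        obtain x b where b: "a = x # b" using a False by (cases a) auto
        with a l show ?thesis
          by (intro bexI[of _ "Suc x # b"]) (auto simp: compositions_def Suc_diff_le replicate_app_Cons_same
              simp flip: replicate_Suc append_Cons)
      qed
    qed
  qed
  with that show ?thesis by blast
qed

lemma last_comp_word: "a \<noteq> [] \<Longrightarrow> last (comp_word a)"
  by (induction a rule: rev_induct) auto

lemma comp_word_eq_Nil_iff [simp]: "comp_word a = [] \<longleftrightarrow> a = []"
  by (cases a) auto

lemma admissible_imp_composition: "a \<in> admissible \<Longrightarrow> a \<in> compositions"
  by (simp add: admissible_def)

lemma Nil_admissible [simp]: "[] \<in> admissible"
  by (simp add: admissible_def compositions_def)

lemma admissible_iff_hd_comp_word:
  assumes "a \<in> compositions" "a \<noteq> []"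
  shows "a \<in> admissible \<longleftrightarrow> \<not> hd (comp_word a)"
proof -
  obtain x b where "a = x # b" using assms(2) by (cases a) auto
  moreover have "x - 1 = 0 \<longleftrightarrow> x = 1 \<or> x = 0" by auto
  ultimately show ?thesis using assms
    by (cases "x - 1") (auto simp: admissible_def compositions_def)
qed

text \<open>The word of a non-empty admissible composition begins with 0 and ends with 1, and
  reversal with exchange of letters preserves this. So a composition as required by
  \<open>dual_def\<close> exists, and injectivity of \<open>comp_word\<close> makes it
  unique.\<close>

lemma dual_props:
  assumes "a \<in> admissible"
  shows "dual a \<in> admissible \<and> comp_word (dual a) = dual_word (comp_word a)"
proof -
  let ?w = "dual_word (comp_word a)"
  have "?w = [] \<or> last ?w"
  proof (cases "a = []")
    case False
    then have "\<not> hd (comp_word a)"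
      using admissible_iff_hd_comp_word assms admissible_imp_composition by blast
    then show ?thesis by (simp add: dual_word_def last_rev hd_map False)
  qed (simp add: dual_word_def)
  then obtain b where b: "b \<in> compositions" "comp_word b = ?w" by (rule comp_word_surj)
  have "b \<in> admissible"
  proof (cases "b = []")
    case False
    then have "a \<noteq> []" using b(2) by (auto simp: dual_word_def)
    have "\<not> hd ?w"
      using last_comp_word[OF \<open>a \<noteq> []\<close>] \<open>a \<noteq> []\<close> by (simp add: dual_word_def hd_rev last_map)
    with False b show ?thesis using admissible_iff_hd_comp_word by simp
  qed simp
  with b have "b \<in> admissible \<and> comp_word b = ?w" by simp
  then show ?thesis unfolding dual_def
    by (rule theI) (use b comp_word_inject admissible_imp_composition in metis)
qed

lemma dual_admissible [simp]: "a \<in> admissible \<Longrightarrow> dual a \<in> admissible"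
  using dual_props by blast

lemma comp_word_dual: "a \<in> admissible \<Longrightarrow> comp_word (dual a) = dual_word (comp_word a)"
  using dual_props by blast

lemma admissible_comp_word_inject:
  "a \<in> admissible \<Longrightarrow> b \<in> admissible \<Longrightarrow> comp_word a = comp_word b \<Longrightarrow> a = b"
  using comp_word_inject admissible_imp_composition by blast

lemma dual_dual [simp]: "a \<in> admissible \<Longrightarrow> dual (dual a) = a"
  by (rule admissible_comp_word_inject) (simp_all add: comp_word_dual)

lemma weight_dual: "a \<in> admissible \<Longrightarrow> weight (dual a) = weight a"
  using length_comp_word[of a] length_comp_word[of "dual a"]
  by (simp add: admissible_imp_composition comp_word_dual dual_word_def)

lemma dual_Nil [simp]: "dual [] = []"
  using comp_word_dual[of "[]"] by (simp add: dual_word_def)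

lemma dual_eq_Nil_iff [simp]: "a \<in> admissible \<Longrightarrow> dual a = [] \<longleftrightarrow> a = []"
  using comp_word_dual[of a] by (auto simp: dual_word_def)

section \<open>Initial, final and middle parts\<close>

lemma comp_init_admissible [simp]:
  assumes "a \<in> admissible"
  shows "comp_init a \<in> admissible"
proof -
  have "hd (butlast a) = hd a" if "butlast a \<noteq> []"
    using that by (cases a) (auto split: if_splits)
  with assms show ?thesis
    by (cases "butlast a = []")
      (auto simp: admissible_def compositions_def comp_init_def dest: in_set_butlastD)
qed

lemma comp_fin_admissible [simp]: "a \<in> admissible \<Longrightarrow> comp_fin a \<in> admissible"
  by (simp add: comp_fin_def)

lemma comp_mid_admissible [simp]: "a \<in> admissible \<Longrightarrow> comp_mid a \<in> admissible"
  by (simp add: comp_mid_def)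

lemma weight_comp_init: "a \<noteq> [] \<Longrightarrow> weight (comp_init a) + last a = weight a"
  unfolding weight_def comp_init_def
  by (metis append_butlast_last_id sum_list_append sum_list.Cons sum_list.Nil add_0_right)

lemma last_pos: "a \<in> admissible \<Longrightarrow> a \<noteq> [] \<Longrightarrow> 0 < last a"
  by (simp add: admissible_def compositions_def)

lemma weight_comp_fin:
  assumes "a \<in> admissible" "a \<noteq> []"
  shows "weight (comp_fin a) + last (dual a) = weight a"
  using weight_comp_init[of "dual a"] assms by (simp add: comp_fin_def weight_dual)

lemma comp_fin_Nil [simp]: "comp_fin [] = []"
  by (simp add: comp_fin_def comp_init_def)

text \<open>Seen on words, fin removes an initial 0 together with the run of letters 1 after it: the
  dual word ends in 0^j 1, which is the last entry j + 1 of the dual composition. Admissibility of f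
  guarantees that the run is complete.\<close>

lemma comp_fin_eqI:
  assumes "a \<in> admissible" "f \<in> admissible"
    and "comp_word a = False # replicate j True @ comp_word f"
  shows "comp_fin a = f"
proof -
  have "comp_word (dual a) = comp_word (dual f @ [Suc j])"
    using assms by (simp add: comp_word_dual) (simp add: dual_word_def)
  moreover have "dual f @ [Suc j] \<in> compositions"
    using admissible_imp_composition[OF dual_admissible[OF assms(2)]] by (auto simp: compositions_def)
  ultimately have "dual a = dual f @ [Suc j]"
    using assms comp_word_inject admissible_imp_composition dual_admissible by blast
  then show ?thesis using assms by (simp add: comp_fin_def comp_init_def)
qed

lemma comp_fin_Cons:
  assumes "h # t \<in> admissible"
  shows "comp_fin (Suc h # t) = h # t"
proof (rule comp_fin_eqI[of _ _ 0])
  have "2 \<le> h" using assms by (simp add: admissible_def)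
  then show "comp_word (Suc h # t) = False # replicate 0 True @ comp_word (h # t)"
    by (cases h) auto
qed (use assms in \<open>auto simp: admissible_def compositions_def\<close>)

lemma comp_fin_2_ones:
  assumes "f \<in> admissible"
  shows "comp_fin (2 # replicate j 1 @ f) = f"
proof (rule comp_fin_eqI[of _ _ "Suc j"])
  \<comment> \<open>The entry 2 contributes the letters 0 1, hence one letter 1 more than the j
    entries 1.\<close>
  have "comp_word (replicate j 1) = replicate j True"
    by (induction j) auto
  then show "comp_word (2 # replicate j 1 @ f) = False # replicate (Suc j) True @ comp_word f"
    by simp
qed (use assms in \<open>auto simp: admissible_def compositions_def\<close>)

text \<open>The two shapes on which fin is explicit: either the first entry is at least 3 and drops
  by 1, or it is 2 and disappears together with the entries 1 that follow.\<close>

lemma admissible_cases: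
  assumes "a \<in> admissible" "a \<noteq> []"
  obtains (Cons) h t where "h # t \<in> admissible" "a = Suc h # t"
  | (ones) j f where "f \<in> admissible" "a = 2 # replicate j 1 @ f"
proof -
  obtain x b where a: "a = x # b" using assms(2) by (cases a) auto
  have "2 \<le> x" using assms a by (simp add: admissible_def)
  show ?thesis
  proof (cases "x = 2")
    case True
    define f where "f = dropWhile (\<lambda>y. y = 1) b"
    have "takeWhile (\<lambda>y. y = 1) b = replicate (length (takeWhile (\<lambda>y. y = 1) b)) 1"
      by (rule replicate_eqI[symmetric, THEN sym]) (auto dest: set_takeWhileD)
    then have b: "b = replicate (length (takeWhile (\<lambda>y. y = 1) b)) 1 @ f"
      unfolding f_def by (metis takeWhile_dropWhile_id)
    have f_pos: "\<forall>y\<in>set f. 0 < y"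
      using assms(1) unfolding a f_def
      by (auto simp: admissible_def compositions_def dest: set_dropWhileD)
    moreover have "2 \<le> hd f" if "f \<noteq> []"
    proof -
      have "hd f \<noteq> 1" using that unfolding f_def by (rule hd_dropWhile)
      moreover have "0 < hd f" using that f_pos by simp
      ultimately show ?thesis by simp
    qed
    ultimately have "f \<in> admissible" by (auto simp: admissible_def compositions_def)
    with b a True show ?thesis by (intro ones[of f "length (takeWhile (\<lambda>y. y = 1) b)"]) auto
  next
    case False
    then obtain h where "x = Suc h" "2 \<le> h" using \<open>2 \<le> x\<close> by (cases x) auto
    with assms a show ?thesis by (intro Cons[of h b]) (auto simp: admissible_def compositions_def)
  qed
qed

text \<open>fin deletes at the front of the word and init at its end. The short compositions, where
  the two deletions overlap, are checked separately.\<close>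

lemma comp_init_comp_fin:
  assumes "a \<in> admissible"
  shows "comp_init (comp_fin a) = comp_fin (comp_init a)"
proof (cases "a = []")
  case True
  then show ?thesis by (simp add: comp_init_def)
next
  case False
  with assms show ?thesis
  proof (cases rule: admissible_cases)
    case (Cons h t)
    show ?thesis
    proof (cases "t = []")
      case True
      with Cons show ?thesis by (simp add: comp_fin_Cons comp_init_def)
    next
      case False
      with Cons(1) have "h # butlast t \<in> admissible"
        using comp_init_admissible[OF Cons(1)] by (simp add: comp_init_def)
      with Cons False show ?thesis by (simp add: comp_fin_Cons comp_init_def)
    qed
  next
    case (ones j f)
    show ?thesis
    proof (cases "f = []")
      \<comment> \<open>For a = (2,1,...,1) fin already removes everything, before or after init, so
        both sides are empty.\<close>
      case True
      have "comp_fin (comp_init a) = []"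
      proof (cases j)
        case 0
        with True ones show ?thesis by (simp add: comp_init_def)
      next
        case (Suc i)
        have "comp_init a = 2 # replicate i 1 @ []"
          unfolding comp_init_def ones True Suc
          by (simp add: replicate_append_same[symmetric] butlast_append del: replicate_Suc)
             (simp add: replicate_append_same[symmetric] butlast_append)
        then show ?thesis using comp_fin_2_ones[of "[]" i] by simp
      qed
      moreover have "comp_fin a = []" using comp_fin_2_ones[OF ones(1), of j] ones(2) True by simp
      ultimately show ?thesis by (simp add: comp_init_def)
    next
      case False
      then have "comp_init a = 2 # replicate j 1 @ comp_init f"
        using ones by (simp add: comp_init_def butlast_append)
      then show ?thesis
        using comp_fin_2_ones[OF ones(1), of j] comp_fin_2_ones[of "comp_init f" j] ones by simp
    qed
  qed
qed

text \<open>Duality conjugates init into fin, so it turns init after fin into fin after init;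
  commutation of the two brings this back to mid. This is the middle term in the well-definedness of
  \<open>alpha\<close>.\<close>

lemma comp_mid_dual:
  assumes "a \<in> admissible"
  shows "comp_mid (dual a) = dual (comp_mid a)"
proof -
  have "comp_mid (dual a) = comp_init (dual (comp_init a))"
    using assms by (simp add: comp_mid_def comp_fin_def)
  moreover have "comp_mid a = dual (comp_init (dual (comp_init a)))"
    unfolding comp_mid_def comp_init_comp_fin[OF assms] comp_fin_def[of "comp_init a"] ..
  ultimately show ?thesis using assms by simp
qed

lemma comp_fin_dual: "a \<in> admissible \<Longrightarrow> comp_fin (dual a) = dual (comp_init a)"
  by (simp add: comp_fin_def)

lemma comp_init_dual: "a \<in> admissible \<Longrightarrow> comp_init (dual a) = dual (comp_fin a)"
  by (simp add: comp_fin_def)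

section \<open>Double tails of multiple zeta values\<close>

text \<open>The convention \<open>inverse 0 = 0\<close> gives \<open>recip 0 = 0\<close>; statements
  about letters at the argument 0 need care for this reason.\<close>

definition recip :: "nat \<Rightarrow> ennreal" where
  "recip n = ennreal (inverse (real n))"

text \<open>Letters act in reading order, so the outermost variable comes first: the letters 0 of an
  entry a_1 supply a_1 - 1 factors 1/n_1, and its letter 1 supplies the last factor and sums over
  n_1 > n_2.\<close>

definition letter_op :: "bool \<Rightarrow> (nat \<Rightarrow> ennreal) \<Rightarrow> nat \<Rightarrow> ennreal" where
  "letter_op l f n =
     (if l then suminf (\<lambda>j. recip (Suc (n + j)) * f (Suc (n + j))) else recip n * f n)"

definition word_op :: "bool list \<Rightarrow> (nat \<Rightarrow> ennreal) \<Rightarrow> nat \<Rightarrow> ennreal" where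
  "word_op w = fold letter_op w"

definition connector :: "nat \<Rightarrow> nat \<Rightarrow> real" where
  "connector n m = 1 / real ((n + m) choose m)"

text \<open>The two-parameter value zeta(a)_{m,n}: m enters the binomial coefficient of the largest
  variable, n bounds the smallest variable from below. Duality exchanges the two parameters.\<close>

definition double_tail :: "nat list \<Rightarrow> nat \<Rightarrow> nat \<Rightarrow> ennreal" where
  "double_tail a m = word_op (comp_word a) (\<lambda>j. ennreal (connector j m))"

lemma word_op_Nil [simp]: "word_op [] f = f"
  by (simp add: word_op_def)

lemma word_op_Cons [simp]: "word_op (l # w) f = word_op w (letter_op l f)"
  by (simp add: word_op_def)

lemma word_op_append [simp]: "word_op (v @ w) f = word_op w (word_op v f)"
  by (simp add: word_op_def)

lemma recip_le_1: "recip n \<le> 1"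
  unfolding recip_def by (cases "n = 0") (auto simp: field_simps)

lemma recip_power: "recip n ^ k = ennreal (inverse (real n) ^ k)"
  unfolding recip_def by (rule ennreal_power) simp

lemma letter_op_True_cong:
  assumes "\<And>n. n \<ge> 1 \<Longrightarrow> f n = g n"
  shows "letter_op True f n = letter_op True g n"
  using assms by (simp add: letter_op_def)

lemma letter_op_cong:
  assumes "\<And>n. n \<ge> 1 \<Longrightarrow> f n = g n" "n \<ge> 1"
  shows "letter_op l f n = letter_op l g n"
  using assms by (simp add: letter_op_def)

lemma word_op_cong:
  assumes "\<And>n. n \<ge> 1 \<Longrightarrow> f n = g n" "n \<ge> 1"
  shows "word_op w f n = word_op w g n"
  using assms
proof (induction w arbitrary: f g)
  case (Cons l w)
  show ?case
    by (simp, rule Cons.IH) (use Cons.prems letter_op_cong[of f g] in auto)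
qed simp

lemma letter_op_mono:
  assumes "\<And>n. n \<ge> 1 \<Longrightarrow> f n \<le> g n" "n \<ge> 1"
  shows "letter_op l f n \<le> letter_op l g n"
  using assms by (auto simp: letter_op_def intro!: suminf_le mult_left_mono)

lemma word_op_mono:
  assumes "\<And>n. n \<ge> 1 \<Longrightarrow> f n \<le> g n" "n \<ge> 1"
  shows "word_op w f n \<le> word_op w g n"
  using assms
proof (induction w arbitrary: f g)
  case (Cons l w)
  show ?case
    by (simp, rule Cons.IH) (use Cons.prems letter_op_mono[of f g] in auto)
qed simp

lemma suminf_swap_ennreal:
  fixes f :: "nat \<Rightarrow> nat \<Rightarrow> ennreal"
  shows "suminf (\<lambda>i. suminf (\<lambda>j. f i j)) = suminf (\<lambda>j. suminf (\<lambda>i. f i j))"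
  using nn_integral_suminf[of "\<lambda>i j. f i j" "count_space UNIV"]
  by (simp add: nn_integral_count_space_nat)

text \<open>The letters act on different variables. For two letters 1 this is Tonelli for series in
  \<open>ennreal\<close>; otherwise factors are moved through a series.\<close>

lemma letter_op_letter_op_commute:
  "letter_op l' (\<lambda>m. letter_op l (\<lambda>n. F n m) n) m = letter_op l (\<lambda>n. letter_op l' (F n) m) n"
proof -
  consider "\<not> l \<and> \<not> l'" | "l \<and> \<not> l'" | "\<not> l \<and> l'" | "l \<and> l'" by blast
  then show ?thesis
  proof cases
    case 4
    show ?thesis
      using 4 suminf_swap_ennreal[of "\<lambda>i j. recip (Suc (m + i)) * (recip (Suc (n + j))
        * F (Suc (n + j)) (Suc (m + i)))"]
      by (simp add: letter_op_def mult_ac flip: ennreal_suminf_cmult)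
  qed (simp_all add: letter_op_def mult_ac flip: ennreal_suminf_cmult)
qed

lemma word_op_letter_op_commute:
  "word_op w (\<lambda>m. letter_op l (\<lambda>n. F n m) n) m = letter_op l (\<lambda>n. word_op w (F n) m) n"
proof (induction w arbitrary: F)
  case (Cons l' w)
  have "letter_op l' (\<lambda>m. letter_op l (\<lambda>n. F n m) n) = (\<lambda>m. letter_op l (\<lambda>n. letter_op l' (F n) m) n)"
    by (rule ext, rule letter_op_letter_op_commute)
  then have "word_op (l' # w) (\<lambda>m. letter_op l (\<lambda>n. F n m) n) m
      = word_op w (\<lambda>m. letter_op l (\<lambda>n. letter_op l' (F n) m) n) m"
    by (simp only: word_op_Cons)
  also have "\<dots> = letter_op l (\<lambda>n. word_op w (letter_op l' (F n)) m) n"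
    by (rule Cons.IH)
  finally show ?case by simp
qed simp

section \<open>The connector and the exchange of letters\<close>

lemma connector_commute: "connector n m = connector m n"
  unfolding connector_def using binomial_symmetric[of m "n + m"] by (simp add: add.commute)

lemma connector_nonneg [simp]: "0 \<le> connector n m"
  by (simp add: connector_def)

lemma connector_Suc:
  "connector n m = connector n (Suc m) * (real (n + Suc m) / real (Suc m))"
proof -
  have "Suc m * ((n + Suc m) choose Suc m) = (n + Suc m) * ((n + m) choose m)"
    using Suc_times_binomial_eq[of "n + m" m] by simp
  then have "real (Suc m) * real ((n + Suc m) choose Suc m)
      = real (n + Suc m) * real ((n + m) choose m)"
    by (metis of_nat_mult)
  then show ?thesis
    unfolding connector_def by (simp add: field_simps del: of_nat_Suc of_nat_add binomial_Suc_Suc)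
qed

lemma connector_telescope:
  "real n * (inverse (real (Suc m)) * connector n (Suc m)) = connector n m - connector n (Suc m)"
  unfolding connector_Suc[of n m] by (simp add: field_simps)

lemma connector_tendsto_0:
  assumes "n \<ge> 1"
  shows "connector n \<longlonglongrightarrow> 0"
proof (rule tendsto_sandwich[of "\<lambda>_. 0" _ _ "\<lambda>m. inverse (real (Suc m))"])
  have "connector n m \<le> inverse (real (Suc m))" for m
  proof -
    have "Suc m = (Suc m) choose m" by simp
    also have "\<dots> \<le> (n + m) choose m"
      using assms by (intro binomial_right_mono) auto
    finally have "real (Suc m) \<le> real ((n + m) choose m)" by (rule of_nat_mono)
    then show ?thesis unfolding connector_def by (simp add: inverse_eq_divide frac_le)
  qed
  then show "\<forall>\<^sub>F m in sequentially. connector n m \<le> inverse (real (Suc m))" by simp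
  show "(\<lambda>m. inverse (real (Suc m))) \<longlonglongrightarrow> 0"
    by (rule LIMSEQ_inverse_real_of_nat)
qed simp_all

text \<open>\<open>connector_telescope\<close> divided by n makes every term a difference, and the
  connector tends to 0 for n \<ge> 1. Thus the letter 1 in m acts on the connector like the letter 0
  in n.\<close>

lemma connector_tail_sums:
  assumes "n \<ge> 1"
  shows "(\<lambda>j. inverse (real (Suc (m + j))) * connector n (Suc (m + j)))
    sums (inverse (real n) * connector n m)"
proof -
  have "(\<lambda>j. connector n (m + j)) \<longlonglongrightarrow> 0"
    using LIMSEQ_ignore_initial_segment[OF connector_tendsto_0[OF assms], of m]
    by (simp add: add.commute)
  from telescope_sums'[OF this]
  have "(\<lambda>j. connector n (m + j) - connector n (m + Suc j)) sums connector n m" by simp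
  from sums_mult[OF this, of "inverse (real n)"]
  have "(\<lambda>j. inverse (real n) * (connector n (m + j) - connector n (m + Suc j)))
    sums (inverse (real n) * connector n m)" .
  moreover have "inverse (real n) * (connector n (m + j) - connector n (m + Suc j))
      = inverse (real (Suc (m + j))) * connector n (Suc (m + j))" for j
    using connector_telescope[of n "m + j"] assms by (simp add: field_simps del: of_nat_Suc)
  ultimately show ?thesis by (simp only:)
qed

lemma letter_op_True_connector:
  assumes "n \<ge> 1"
  shows "letter_op True (\<lambda>m. ennreal (connector n m)) m
    = recip n * ennreal (connector n m)"
proof -
  have "letter_op True (\<lambda>m. ennreal (connector n m)) m
    = suminf (\<lambda>j. ennreal (inverse (real (Suc (m + j))) * connector n (Suc (m + j))))"
    by (simp add: letter_op_def recip_def ennreal_mult del: of_nat_Suc)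
  also have "\<dots> = ennreal (inverse (real n) * connector n m)"
    using connector_tail_sums[OF assms, of m]
    by (subst suminf_ennreal2) (auto simp: sums_iff simp del: of_nat_Suc)
  finally show ?thesis by (simp add: recip_def ennreal_mult)
qed

text \<open>The variable on which the letter 0 acts must be positive: at 0 that letter gives 0,
  whereas the series in the other variable is a tail of the harmonic series.\<close>

lemma letter_op_connector_swap:
  assumes "l \<longrightarrow> m \<ge> 1" "\<not> l \<longrightarrow> n \<ge> 1"
  shows "letter_op l (\<lambda>n. ennreal (connector n m)) n
    = letter_op (\<not> l) (\<lambda>m. ennreal (connector n m)) m"
proof (cases l)
  case True
  with assms letter_op_True_connector[of m n] show ?thesis
    by (simp add: connector_commute[of _ m]) (simp add: letter_op_def connector_commute[of m])
next
  case False
  with assms letter_op_True_connector[of n m] show ?thesis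
    by simp (simp add: letter_op_def)
qed

text \<open>The first letter of the word acts directly on the connector, so it can be traded for the
  opposite letter in m. It commutes with the rest of the word in n and therefore acts last in m,
  which is why the word is reversed.\<close>

lemma word_op_connector_swap:
  assumes "n \<ge> 1" "m \<ge> 1"
  shows "word_op u (\<lambda>n. ennreal (connector n m)) n
    = word_op (dual_word u) (\<lambda>m. ennreal (connector n m)) m"
  using assms
proof (induction u arbitrary: n m)
  case Nil
  then show ?case by (simp add: dual_word_def)
next
  case (Cons l u)
  have "word_op (l # u) (\<lambda>n. ennreal (connector n m)) n
      = word_op u (\<lambda>n. letter_op (\<not> l) (\<lambda>m. ennreal (connector n m)) m) n"
    using Cons.prems by simp (intro word_op_cong letter_op_connector_swap, auto)
  also have "\<dots> = letter_op (\<not> l) (\<lambda>m. word_op u (\<lambda>n. ennreal (connector n m)) n) m"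
    using word_op_letter_op_commute[of u "\<not> l" "\<lambda>m n. ennreal (connector n m)"] .
  also have "\<dots> = letter_op (\<not> l) (word_op (dual_word u) (\<lambda>m. ennreal (connector n m))) m"
    using Cons by (intro letter_op_cong) auto
  also have "\<dots> = word_op (dual_word (l # u)) (\<lambda>m. ennreal (connector n m)) m"
    by (simp add: dual_word_def)
  finally show ?case .
qed

text \<open>Parameters equal to 0 are reached here. The final 1 sums over arguments above n, and the
  initial 0 becomes a sum over arguments above m, so the core u is exchanged only at positive
  arguments.\<close>

lemma word_op_admissible_connector_swap:
  "word_op (False # u @ [True]) (\<lambda>n. ennreal (connector n m)) n
    = word_op (False # dual_word u @ [True]) (\<lambda>m. ennreal (connector n m)) m"
proof -
  let ?C = "\<lambda>n m. ennreal (connector n m)"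
  have "word_op (False # u @ [True]) (\<lambda>n. ?C n m) n
      = letter_op True (word_op u (letter_op False (\<lambda>n. ?C n m))) n"
    by simp
  also have "\<dots> = letter_op True (\<lambda>n. word_op u (\<lambda>n. letter_op True (?C n) m) n) n"
    using letter_op_connector_swap[of False]
    by (intro letter_op_True_cong word_op_cong) auto
  also have "\<dots> = letter_op True (\<lambda>n. letter_op True (\<lambda>m. word_op u (\<lambda>n. ?C n m) n) m) n"
    by (subst word_op_letter_op_commute[of u True "\<lambda>m n. ?C n m"]) (rule refl)
  also have "\<dots> = letter_op True (\<lambda>n. letter_op True (\<lambda>m. word_op (dual_word u) (?C n) m) m) n"
    by (intro letter_op_True_cong word_op_connector_swap)
  also have "\<dots> = letter_op True (\<lambda>m. letter_op True (\<lambda>n. word_op (dual_word u) (?C n) m) n) m"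
    by (rule letter_op_letter_op_commute[symmetric])
  also have "\<dots> = letter_op True (\<lambda>m. word_op (dual_word u) (\<lambda>m. letter_op True (\<lambda>n. ?C n m) n) m) m"
    by (subst word_op_letter_op_commute[of "dual_word u" True ?C]) (rule refl)
  also have "\<dots> = letter_op True (\<lambda>m. word_op (dual_word u) (letter_op False (?C n)) m) m"
    using letter_op_connector_swap[of True]
    by (intro letter_op_True_cong word_op_cong) auto
  finally show ?thesis by simp
qed

lemma double_tail_dual:
  assumes "a \<in> admissible"
  shows "double_tail (dual a) n m = double_tail a m n"
proof (cases "a = []")
  case True
  then show ?thesis by (simp add: double_tail_def connector_commute)
next
  case False
  have "last (comp_word a)" "\<not> hd (comp_word a)" "comp_word a \<noteq> []"
    using False assms last_comp_word admissible_iff_hd_comp_word admissible_imp_composition by auto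
  then obtain u where u: "comp_word a = False # u @ [True]"
    by (cases "comp_word a"; cases "tl (comp_word a)" rule: rev_cases) auto
  then have "comp_word (dual a) = False # dual_word u @ [True]"
    by (simp add: comp_word_dual[OF assms] dual_word_def)
  with u show ?thesis
    unfolding double_tail_def
    using word_op_admissible_connector_swap[of u m n] by (simp add: connector_commute[of _ n])
qed

section \<open>Recursion in the two parameters, and finiteness\<close>

lemma letter_op_True_pred:
  assumes "n \<ge> 1"
  shows "letter_op True f (n - 1) = letter_op True f n + recip n * f n"
proof -
  obtain k where k: "n = Suc k" using assms by (cases n) auto
  let ?g = "\<lambda>j. recip (Suc (k + j)) * f (Suc (k + j))"
  have "?g sums (suminf (\<lambda>j. ?g (Suc j)) + ?g 0)"
    by (intro sums_Suc summable_sums summableI)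
  then show ?thesis unfolding k letter_op_def by (simp add: sums_iff)
qed

lemma word_op_replicate_False: "word_op (replicate k False) f n = recip n ^ k * f n"
  by (induction k arbitrary: f) (simp_all add: letter_op_def mult_ac)

lemma double_tail_snoc:
  assumes "c \<ge> 1"
  shows "double_tail (b @ [c]) m n
    = letter_op True (\<lambda>j. recip j ^ (c - 1) * double_tail b m j) n"
  unfolding double_tail_def by (simp add: word_op_replicate_False[abs_def])

lemma double_tail_pred:
  assumes "a \<in> admissible" "a \<noteq> []" "n \<ge> 1"
  shows "double_tail a m (n - 1)
    = double_tail a m n + recip n ^ last a * double_tail (comp_init a) m n"
proof -
  define b c where "b = comp_init a" and "c = last a"
  have a: "a = b @ [c]" using assms(2) by (simp add: b_def c_def comp_init_def)
  have "c \<ge> 1" using last_pos[OF assms(1,2)] by (simp add: c_def)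
  then have "recip n * (recip n ^ (c - 1) * x) = recip n ^ c * x" for x
    by (cases c) (auto simp: mult_ac)
  with \<open>c \<ge> 1\<close> show ?thesis
    unfolding b_def[symmetric] c_def[symmetric] unfolding a
    by (simp only: double_tail_snoc letter_op_True_pred[OF assms(3)])
qed

text \<open>Duality turns lowering m into lowering n, and thereby init into fin.\<close>

lemma double_tail_pred':
  assumes "a \<in> admissible" "a \<noteq> []" "m \<ge> 1"
  shows "double_tail a (m - 1) n
    = double_tail a m n + recip m ^ last (dual a) * double_tail (comp_fin a) m n"
proof -
  have "double_tail a (m - 1) n = double_tail (dual a) n (m - 1)"
    using double_tail_dual[OF assms(1)] by simp
  also have "\<dots> = double_tail (dual a) n m
      + recip m ^ last (dual a) * double_tail (comp_init (dual a)) n m"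
    using assms by (intro double_tail_pred) auto
  also have "double_tail (dual a) n m = double_tail a m n"
    by (rule double_tail_dual[OF assms(1)])
  also have "double_tail (comp_init (dual a)) n m = double_tail (comp_fin a) m n"
    unfolding comp_fin_def using assms by (intro double_tail_dual[symmetric]) simp
  finally show ?thesis .
qed

lemma connector_pred_diag: "n \<ge> 1 \<Longrightarrow> connector (n - 1) n = 2 * connector n n"
  using connector_Suc[of n "n - 1"] connector_commute[of "n - 1" n]
  by (cases n) (auto simp: divide_eq_eq algebra_simps)

text \<open>Lowering m and then n yields the terms of fin and init. The fin term is still taken at
  (n, n - 1), and lowering its second parameter produces the mid term.\<close>

lemma double_tail_diag_pred:
  assumes a: "a \<in> admissible" "a \<noteq> []" and n: "n \<ge> 1"
  shows "double_tail a (n - 1) (n - 1) = double_tail a n n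
    + recip n ^ (weight a - weight (comp_init a)) * double_tail (comp_init a) n n
    + recip n ^ (weight a - weight (comp_mid a)) * double_tail (comp_mid a) n n
    + recip n ^ (weight a - weight (comp_fin a)) * double_tail (comp_fin a) n n"
proof -
  let ?b = "last (dual a)"
  have init: "weight a - weight (comp_init a) = last a" using weight_comp_init[OF a(2)] by simp
  have fin: "weight a - weight (comp_fin a) = ?b" using weight_comp_fin[OF a] by simp
  have "double_tail a (n - 1) (n - 1) = double_tail a n n
     + recip n ^ last a * double_tail (comp_init a) n n
     + recip n ^ ?b * double_tail (comp_fin a) n (n - 1)"
    by (simp only: double_tail_pred'[OF a n, of "n - 1"] double_tail_pred[OF a n, of n])
  also have "recip n ^ ?b * double_tail (comp_fin a) n (n - 1)
     = recip n ^ ?b * double_tail (comp_fin a) n n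
      + recip n ^ (weight a - weight (comp_mid a)) * double_tail (comp_mid a) n n"
  proof (cases "comp_fin a = []")
    case True
    then have "comp_mid a = []" by (simp add: comp_mid_def comp_init_def)
    moreover have "weight a = ?b" using weight_comp_fin[OF a] True by (simp add: weight_def)
    ultimately show ?thesis
      using True connector_pred_diag[OF n]
      by (simp add: double_tail_def weight_def connector_commute[of n "n - 1"]
          connector_commute[of n "n - Suc 0"] flip: distrib_left ennreal_plus)
  next
    case False
    have "weight (comp_mid a) + last (comp_fin a) = weight (comp_fin a)"
      using weight_comp_init[OF False] by (simp add: comp_mid_def)
    then have "weight a - weight (comp_mid a) = ?b + last (comp_fin a)"
      using weight_comp_fin[OF a] by simp
    with double_tail_pred[OF comp_fin_admissible[OF a(1)] False n, of n] show ?thesis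
      by (simp only: comp_mid_def distrib_left power_add mult.assoc)
  qed
  finally show ?thesis unfolding init fin by (simp add: add_ac)
qed

text \<open>Either letter multiplies the connector by the reciprocal of one of the two variables, so
  at positive arguments a word can only decrease it.\<close>

lemma double_tail_le_connector:
  assumes "n \<ge> 1" "m \<ge> 1"
  shows "double_tail a m n \<le> ennreal (connector n m)"
proof -
  have "word_op w (\<lambda>n. ennreal (connector n m)) n \<le> ennreal (connector n m)" for w
  proof (induction w)
    case (Cons l w)
    have le: "recip k * x \<le> x" for k and x :: ennreal
      using mult_right_mono[OF recip_le_1, of x k] by simp
    have "letter_op l (\<lambda>n. ennreal (connector n m)) k \<le> ennreal (connector k m)" if "k \<ge> 1" for k
    proof (cases l)
      case True
      then have "letter_op l (\<lambda>n. ennreal (connector n m)) k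
          = letter_op False (\<lambda>m. ennreal (connector k m)) m"
        using letter_op_connector_swap[of True m k] assms by simp
      then show ?thesis by (simp add: letter_op_def le)
    qed (simp add: letter_op_def le)
    then have "word_op (l # w) (\<lambda>n. ennreal (connector n m)) n
        \<le> word_op w (\<lambda>n. ennreal (connector n m)) n"
      by (simp only: word_op_Cons, intro word_op_mono assms)
    with Cons.IH show ?case by simp
  qed simp
  then show ?thesis unfolding double_tail_def .
qed

text \<open>The bound by the connector covers n \<ge> 1. The recursion at n = 1, valid in
  \<open>ennreal\<close> without knowing convergence, carries finiteness down to 0.\<close>

lemma double_tail_finite:
  assumes "a \<in> admissible"
  shows "double_tail a n n < top_class.top"
proof (cases "n \<ge> 1")
  case True
  then show ?thesis
    by (intro le_less_trans[OF double_tail_le_connector[OF True True] ennreal_less_top])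
next
  case n: False
  have fin: "double_tail b 1 1 < top_class.top" for b
    by (rule le_less_trans[OF double_tail_le_connector ennreal_less_top]) simp_all
  show ?thesis
  proof (cases "a = []")
    case True
    then show ?thesis by (simp add: double_tail_def)
  next
    case False
    have "recip 1 = 1" by (simp add: recip_def)
    with double_tail_diag_pred[OF assms False, of 1] have "double_tail a 0 0
        = double_tail a 1 1 + double_tail (comp_init a) 1 1 + double_tail (comp_mid a) 1 1
          + double_tail (comp_fin a) 1 1" by simp
    with n show ?thesis by (simp add: fin[simplified] not_le)
  qed
qed

section \<open>Double tails as sums over decreasing tuples\<close>

lemma decreasing_tuples_0: "decreasing_tuples 0 n = {[]}"
  by (auto simp: decreasing_tuples_def)

lemma bij_betw_decreasing_tuples_Suc:
  "bij_betw (\<lambda>(j, ns). ns @ [j]) (Sigma {n<..} (decreasing_tuples r)) (decreasing_tuples (Suc r) n)"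
proof (rule bij_betwI[where g = "\<lambda>ns. (last ns, butlast ns)"])
  show "(\<lambda>(j, ns). ns @ [j]) \<in> Sigma {n<..} (decreasing_tuples r) \<rightarrow> decreasing_tuples (Suc r) n"
    by (auto simp: decreasing_tuples_def sorted_wrt_append) (meson less_trans)
  show "(\<lambda>ns. (last ns, butlast ns)) \<in> decreasing_tuples (Suc r) n \<rightarrow> Sigma {n<..} (decreasing_tuples r)"
  proof
    fix ns assume ns: "ns \<in> decreasing_tuples (Suc r) n"
    then obtain ms j where "ns = ms @ [j]" by (cases ns rule: rev_cases) (auto simp: decreasing_tuples_def)
    with ns show "(last ns, butlast ns) \<in> Sigma {n<..} (decreasing_tuples r)"
      by (auto simp: decreasing_tuples_def sorted_wrt_append)
  qed
  show "(\<lambda>(j, ns). ns @ [j]) (last ns, butlast ns) = ns" if "ns \<in> decreasing_tuples (Suc r) n" for ns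
    using that by (cases ns rule: rev_cases) (auto simp: decreasing_tuples_def)
qed auto

text \<open>Appending n gives the empty tuple the head n, so that the induction on the composition
  starts from the connector at (n, m).\<close>

definition tail_term :: "nat list \<Rightarrow> nat \<Rightarrow> nat \<Rightarrow> nat list \<Rightarrow> real" where
  "tail_term a m n ns =
     connector (hd (ns @ [n])) m * (\<Prod>i<length a. 1 / real (ns ! i) ^ (a ! i))"

lemma tail_term_nonneg [simp]: "0 \<le> tail_term a m n ns"
  unfolding tail_term_def by (intro mult_nonneg_nonneg prod_nonneg) auto

text \<open>Induction from the end of the composition: the last entry belongs to the smallest
  variable j, and j is the lower bound for the tuple of the remaining ones. All terms are
  nonnegative, so the iterated sum is a sum over tuples.\<close>

lemma has_sum_double_tail:
  assumes "a \<in> compositions" "double_tail a m n < top_class.top"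
  shows "(tail_term a m n has_sum enn2real (double_tail a m n)) (decreasing_tuples (length a) n)"
  using assms
proof (induction a arbitrary: n rule: rev_induct)
  case Nil
  show ?case
    by (simp add: decreasing_tuples_0 tail_term_def double_tail_def has_sum_finite_iff)
next
  case (snoc c b)
  have "c \<ge> 1" and b: "b \<in> compositions" using snoc.prems(1) by (auto simp: compositions_def)
  define D where "D j = inverse (real j) ^ c * enn2real (double_tail b m j)" for j
  have rec: "double_tail (b @ [c]) m n
      = suminf (\<lambda>j. recip (Suc (n + j)) ^ c * double_tail b m (Suc (n + j)))"
  proof -
    obtain d where "c = Suc d" using \<open>c \<ge> 1\<close> by (cases c) auto
    then show ?thesis
      unfolding double_tail_snoc[OF \<open>c \<ge> 1\<close>] letter_op_def by (simp add: mult.assoc)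
  qed
  \<comment> \<open>A term of a finite series is finite, and its factor j^(-c) is nonzero because j
    > n.\<close>
  have fin: "double_tail b m j < top_class.top" if jn: "j > n" for j
  proof -
    obtain i where i: "j = Suc (n + i)" using less_imp_Suc_add[OF jn] by (elim exE)
    have "suminf (\<lambda>j. recip (Suc (n + j)) ^ c * double_tail b m (Suc (n + j))) < top_class.top"
      using snoc.prems(2) unfolding rec .
    then have "recip (Suc (n + i)) ^ c * double_tail b m (Suc (n + i)) < top_class.top"
      by (rule ennreal_suminf_lessD)
    moreover have "recip (Suc (n + i)) ^ c \<noteq> 0"
      unfolding recip_power by (simp del: of_nat_Suc)
    ultimately have "double_tail b m (Suc (n + i)) = 0 \<or> double_tail b m (Suc (n + i)) < top_class.top"
      unfolding ennreal_mult_less_top by blast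
    then show ?thesis unfolding i by (metis ennreal_zero_less_top)
  qed
  have D: "ennreal (D j) = recip j ^ c * double_tail b m j" if "j > n" for j
    unfolding D_def recip_power using fin[OF that]
    by (subst ennreal_mult) simp_all
  have D_nonneg: "0 \<le> D j" for j unfolding D_def by simp
  have sumD: "suminf (\<lambda>j. ennreal (D (Suc (n + j)))) = double_tail (b @ [c]) m n"
    unfolding rec by (simp add: D)
  have "summable (\<lambda>j. D (Suc (n + j)))"
    using D_nonneg sumD snoc.prems(2) by (intro summable_suminf_not_top) auto
  moreover have "suminf (\<lambda>j. D (Suc (n + j))) = enn2real (double_tail (b @ [c]) m n)"
    unfolding sumD[symmetric] using D_nonneg calculation
    by (simp add: suminf_ennreal2 suminf_nonneg)
  ultimately have "(\<lambda>j. D (Suc (n + j))) sums enn2real (double_tail (b @ [c]) m n)"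
    by (simp add: sums_iff)
  then have "((\<lambda>j. D (Suc (n + j))) has_sum enn2real (double_tail (b @ [c]) m n)) UNIV"
    using D_nonneg by (intro sums_nonneg_imp_has_sum)
  moreover have bij: "bij_betw (\<lambda>j. Suc (n + j)) UNIV {n<..}"
    by (rule bij_betwI[where g = "\<lambda>j. j - Suc n"]) auto
  ultimately have hsD: "(D has_sum enn2real (double_tail (b @ [c]) m n)) {n<..}"
    by (simp add: has_sum_reindex_bij_betw[OF bij])
  let ?f = "\<lambda>(j, ns). tail_term (b @ [c]) m n (ns @ [j])"
  have term_eq: "tail_term (b @ [c]) m n (ns @ [j]) = inverse (real j) ^ c * tail_term b m j ns"
    if "ns \<in> decreasing_tuples (length b) j" for j ns
  proof -
    have len: "length ns = length b" using that by (simp add: decreasing_tuples_def)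
    have "hd ((ns @ [j]) @ [n]) = hd (ns @ [j])" by (cases ns) auto
    moreover have "(\<Prod>i<length b. 1 / real ((ns @ [j]) ! i) ^ ((b @ [c]) ! i))
        = (\<Prod>i<length b. 1 / real (ns ! i) ^ (b ! i))"
      using len by (intro prod.cong) (auto simp: nth_append)
    ultimately show ?thesis
      unfolding tail_term_def using len
      by (simp add: nth_append power_inverse divide_inverse mult_ac)
  qed
  have inner: "((\<lambda>ns. ?f (j, ns)) has_sum D j) (decreasing_tuples (length b) j)" if "j \<in> {n<..}" for j
  proof -
    have "((\<lambda>ns. inverse (real j) ^ c * tail_term b m j ns) has_sum D j) (decreasing_tuples (length b) j)"
      unfolding D_def using snoc.IH[OF b fin[of j]] that
      by (intro has_sum_cmult_right) auto
    then show ?thesis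
      by (rule has_sum_cong[THEN iffD1, rotated]) (simp add: term_eq)
  qed
  have "(?f has_sum enn2real (double_tail (b @ [c]) m n))
      (Sigma {n<..} (decreasing_tuples (length b)))"
  proof (rule has_sum_SigmaI[OF inner hsD])
    show "?f summable_on Sigma {n<..} (decreasing_tuples (length b))"
      by (rule summable_on_SigmaI[OF inner])
        (use hsD in \<open>auto simp: summable_on_def\<close>)
  qed
  then have "((\<lambda>x. tail_term (b @ [c]) m n ((\<lambda>(j, ns). ns @ [j]) x))
      has_sum enn2real (double_tail (b @ [c]) m n)) (Sigma {n<..} (decreasing_tuples (length b)))"
    by (simp add: case_prod_unfold)
  then show ?case
    unfolding has_sum_reindex_bij_betw[OF bij_betw_decreasing_tuples_Suc] by simp
qed

lemma zeta_tail_eq_double_tail: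
  assumes "a \<in> admissible"
  shows "zeta_tail a n = enn2real (double_tail a n n)"
proof (cases "a = []")
  case True
  then show ?thesis by (simp add: zeta_tail_def double_tail_def connector_def mult_2)
next
  case False
  have "(tail_term a n n has_sum enn2real (double_tail a n n)) (decreasing_tuples (length a) n)"
    using assms admissible_imp_composition double_tail_finite by (intro has_sum_double_tail) auto
  then have "infsum (tail_term a n n) (decreasing_tuples (length a) n) = enn2real (double_tail a n n)"
    by (rule infsumI)
  moreover have "infsum (tail_term a n n) (decreasing_tuples (length a) n) = zeta_tail a n"
  proof -
    have "hd (ns @ [n]) = hd ns" if "ns \<in> decreasing_tuples (length a) n" for ns
      using that False by (cases ns) (auto simp: decreasing_tuples_def)
    with False show ?thesis
      unfolding zeta_tail_def by (auto simp: tail_term_def connector_def intro!: infsum_cong)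
  qed
  ultimately show ?thesis by simp
qed

lemma zeta_tail_dual: "a \<in> admissible \<Longrightarrow> zeta_tail (dual a) n = zeta_tail a n"
  by (simp add: zeta_tail_eq_double_tail double_tail_dual)

lemma zeta_tail_pred:
  assumes a: "a \<in> admissible" "a \<noteq> []" and n: "n \<ge> 1"
  shows "zeta_tail a (n - 1) = zeta_tail a n
    + inverse (real n) ^ (weight a - weight (comp_init a)) * zeta_tail (comp_init a) n
    + inverse (real n) ^ (weight a - weight (comp_mid a)) * zeta_tail (comp_mid a) n
    + inverse (real n) ^ (weight a - weight (comp_fin a)) * zeta_tail (comp_fin a) n"
proof -
  have e: "double_tail b k k = ennreal (zeta_tail b k)" if "b \<in> admissible" for b k
    unfolding zeta_tail_eq_double_tail[OF that]
    by (rule ennreal_enn2real[OF double_tail_finite[OF that], symmetric])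
  have nn: "0 \<le> zeta_tail b k" if "b \<in> admissible" for b k
    by (simp add: zeta_tail_eq_double_tail[OF that])
  have "ennreal (zeta_tail a (n - 1)) = ennreal (zeta_tail a n
    + inverse (real n) ^ (weight a - weight (comp_init a)) * zeta_tail (comp_init a) n
    + inverse (real n) ^ (weight a - weight (comp_mid a)) * zeta_tail (comp_mid a) n
    + inverse (real n) ^ (weight a - weight (comp_fin a)) * zeta_tail (comp_fin a) n)"
  proof -
    have "0 \<le> inverse (real n) ^ i" for i by simp
    then show ?thesis
      using double_tail_diag_pred[OF a n] a(1) nn
      by (simp only: recip_power e comp_init_admissible comp_mid_admissible comp_fin_admissible
          ennreal_plus ennreal_mult add_nonneg_nonneg mult_nonneg_nonneg)
  qed
  then show ?thesis
    by (subst (asm) ennreal_inj) (use a nn in \<open>auto intro!: add_nonneg_nonneg mult_nonneg_nonneg\<close>)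
qed

lemma zeta_tail_tendsto_0:
  assumes "a \<in> admissible"
  shows "zeta_tail a \<longlonglongrightarrow> 0"
proof (rule tendsto_sandwich[of "\<lambda>_. 0" _ _ "connector 1"])
  have "zeta_tail a n \<le> connector 1 n" if "n \<ge> 1" for n
  proof -
    have "zeta_tail a n \<le> connector n n"
      unfolding zeta_tail_eq_double_tail[OF assms]
      using double_tail_le_connector[OF that that, of a] by (simp add: enn2real_leI)
    also have "(1 + n) choose n \<le> (n + n) choose n" using that by (intro binomial_right_mono) auto
    then have "connector n n \<le> connector 1 n"
      unfolding connector_def by (intro divide_left_mono of_nat_mono) auto
    finally show ?thesis .
  qed
  then show "\<forall>\<^sub>F n in sequentially. zeta_tail a n \<le> connector 1 n"
    unfolding eventually_sequentially by blast
  show "connector 1 \<longlonglongrightarrow> 0" by (rule connector_tendsto_0) simp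
  show "\<forall>\<^sub>F n in sequentially. 0 \<le> zeta_tail a n"
    by (simp add: zeta_tail_eq_double_tail[OF assms])
qed simp

text \<open>Origin of the factor: raising one index from n - 1 to n costs (2n - 1)/n, raising the
  other one costs 2, and the product is 4 - 2/n.\<close>

lemma zeta_tail_Nil_pred:
  assumes "n \<ge> 1"
  shows "zeta_tail [] (n - 1) = (4 - 2 / real n) * zeta_tail [] n"
proof -
  obtain k where k: "n = Suc k" using assms by (cases n) auto
  have z: "zeta_tail [] j = connector j j" for j
    by (simp add: zeta_tail_def connector_def mult_2)
  have "connector k k = connector k (Suc k) * (real (k + Suc k) / real (Suc k))"
    by (rule connector_Suc)
  also have "connector k (Suc k) = 2 * connector (Suc k) (Suc k)"
    using connector_pred_diag[of "Suc k"] by simp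
  finally show ?thesis unfolding k z by (simp add: field_simps)
qed

lemma zeta_tail_Nil_nonzero: "zeta_tail [] n \<noteq> 0"
  by (simp add: zeta_tail_def)

section \<open>Relations between classes of compositions\<close>

lemma cls_eq: "a \<in> admissible \<Longrightarrow> cls a = {a, dual a}"
  by (auto simp: cls_def dual_rel_def)

lemma cls_dual: "a \<in> admissible \<Longrightarrow> cls (dual a) = cls a"
  by (auto simp: cls_eq)

lemma zeta_class_cls: "a \<in> admissible \<Longrightarrow> zeta_class (cls a) n = zeta_tail a n"
  by (simp add: zeta_class_def cls_eq zeta_tail_dual)

text \<open>Passing to the dual swaps the classes of init and fin and fixes that of mid, so both
  representatives have the same image and \<open>the_elem\<close> is meaningful.\<close>

lemma alpha_class_cls:
  assumes "a \<in> admissible"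
  shows "alpha_class (cls a) = frag_of (cls (comp_init a)) + frag_of (cls (comp_mid a))
    + frag_of (cls (comp_fin a))"
proof -
  have "frag_of (cls (comp_init (dual a))) + frag_of (cls (comp_mid (dual a)))
      + frag_of (cls (comp_fin (dual a)))
    = frag_of (cls (comp_init a)) + frag_of (cls (comp_mid a)) + frag_of (cls (comp_fin a))"
    using assms by (simp add: comp_init_dual comp_mid_dual comp_fin_dual cls_dual add_ac)
  then show ?thesis unfolding alpha_class_def cls_eq[OF assms] by simp
qed

definition class_weight :: "nat list set \<Rightarrow> nat" where
  "class_weight c = weight (SOME a. a \<in> c)"

lemma class_weight_cls:
  assumes "a \<in> admissible"
  shows "class_weight (cls a) = weight a"
proof -
  have "(SOME b. b \<in> cls a) \<in> cls a"
    by (rule someI[of _ a]) (simp add: cls_eq assms)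
  then show ?thesis
    unfolding class_weight_def using assms by (auto simp: cls_eq weight_dual)
qed

lemma dual_classes_wtE:
  assumes "c \<in> dual_classes_wt k"
  obtains a where "a \<in> admissible" "weight a = k" "c = cls a"
  using assms unfolding dual_classes_wt_def by blast

lemma class_weight_eq: "c \<in> dual_classes_wt k \<Longrightarrow> class_weight c = k"
  by (auto elim!: dual_classes_wtE simp: class_weight_cls)

lemma dual_classes_wt_unique: "c \<in> dual_classes_wt i \<Longrightarrow> c \<in> dual_classes_wt j \<Longrightarrow> i = j"
  using class_weight_eq by blast

lemma cls_in_dual_classes_wt:
  "a \<in> admissible \<Longrightarrow> cls a \<in> dual_classes_wt k \<longleftrightarrow> weight a = k"
  using class_weight_eq[of "cls a" k] by (auto simp: class_weight_cls dual_classes_wt_def)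

lemma dual_classes_wt_subset: "dual_classes_wt k \<subseteq> dual_classes"
  unfolding dual_classes_wt_def dual_classes_def cls_def by (auto intro: quotientI)

lemma finite_dual_classes_wt: "finite (dual_classes_wt k)"
proof -
  have "finite {a \<in> admissible. weight a = k}"
  proof (rule finite_imageD)
    have "comp_word ` {a \<in> admissible. weight a = k} \<subseteq> {w. set w \<subseteq> UNIV \<and> length w = k}"
      using length_comp_word admissible_imp_composition by auto
    then show "finite (comp_word ` {a \<in> admissible. weight a = k})"
      by (rule finite_subset[OF _ finite_lists_length_eq]) simp
    show "inj_on comp_word {a \<in> admissible. weight a = k}"
      by (rule inj_onI) (auto intro: admissible_comp_word_inject)
  qed
  moreover have "dual_classes_wt k = cls ` {a \<in> admissible. weight a = k}"
    unfolding dual_classes_wt_def by blast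
  ultimately show ?thesis by simp
qed

lemma dual_classes_wt_0: "dual_classes_wt 0 = {cls []}"
proof -
  have "a = []" if "a \<in> admissible" "weight a = 0" for a
    using last_pos[OF that(1)] weight_comp_init[of a] that(2) by fastforce
  then show ?thesis unfolding dual_classes_wt_def by (auto simp: weight_def)
qed

section \<open>Linear extension and weight components\<close>

lemma zeta_lin_superset:
  assumes "finite S" "Poly_Mapping.keys l \<subseteq> S"
  shows "zeta_lin l n = (\<Sum>c\<in>S. of_int (Poly_Mapping.lookup l c) * zeta_class c n)"
  unfolding zeta_lin_def using assms
  by (intro sum.mono_neutral_left) (auto simp: in_keys_iff)

lemma zeta_lin_add: "zeta_lin (x + y) n = zeta_lin x n + zeta_lin y n"
proof -
  let ?S = "Poly_Mapping.keys x \<union> Poly_Mapping.keys y"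
  have "Poly_Mapping.keys (x + y) \<subseteq> ?S" by (rule Poly_Mapping.keys_add)
  then show ?thesis
    by (simp add: zeta_lin_superset[of ?S] lookup_add distrib_right sum.distrib)
qed

lemma zeta_lin_cmul: "zeta_lin (frag_cmul k x) n = of_int k * zeta_lin x n"
  by (subst zeta_lin_superset[OF finite_keys keys_cmul])
    (simp add: zeta_lin_def sum_distrib_left mult.assoc)

lemma zeta_lin_0 [simp]: "zeta_lin 0 n = 0"
  by (simp add: zeta_lin_def)

lemma zeta_lin_sum: "zeta_lin (\<Sum>i\<in>A. f i) n = (\<Sum>i\<in>A. zeta_lin (f i) n)"
  by (induction A rule: infinite_finite_induct) (simp_all add: zeta_lin_add)

lemma zeta_lin_frag_of [simp]: "zeta_lin (frag_of c) n = zeta_class c n"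
  by (simp add: zeta_lin_def)

lemma lookup_wt_component:
  "Poly_Mapping.lookup (wt_component j x) c
    = (if c \<in> dual_classes_wt j then Poly_Mapping.lookup x c else 0)"
proof -
  have "Poly_Mapping.lookup (wt_component j x) c
    = (\<Sum>i\<in>Poly_Mapping.keys x. if i = c then
        (if c \<in> dual_classes_wt j then Poly_Mapping.lookup x c else 0) else 0)"
    unfolding wt_component_def frag_extend_def lookup_sum by (intro sum.cong) auto
  also have "\<dots> = (if c \<in> dual_classes_wt j then Poly_Mapping.lookup x c else 0)"
    by (auto simp: in_keys_iff)
  finally show ?thesis .
qed

lemma wt_component_in_free_Z: "wt_component j x \<in> free_Z (dual_classes_wt j)"
  by (auto simp: in_keys_iff lookup_wt_component split: if_splits)

lemma zeta_lin_wt_component: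
  "zeta_lin (wt_component j x) n
    = (\<Sum>c\<in>dual_classes_wt j. of_int (Poly_Mapping.lookup x c) * zeta_class c n)"
  using wt_component_in_free_Z[of j x]
  by (subst zeta_lin_superset[OF finite_dual_classes_wt[of j]]) (auto simp: lookup_wt_component)

lemma sum_wt_components:
  assumes "Poly_Mapping.keys x \<subseteq> (\<Union>j<k. dual_classes_wt j)"
  shows "(\<Sum>j<k. wt_component j x) = x"
proof (rule poly_mapping_eqI)
  fix c
  show "Poly_Mapping.lookup (\<Sum>j<k. wt_component j x) c = Poly_Mapping.lookup x c"
  proof (cases "c \<in> Poly_Mapping.keys x")
    case True
    with assms obtain i where i: "i < k" "c \<in> dual_classes_wt i" by blast
    have "(\<Sum>j<k. if c \<in> dual_classes_wt j then Poly_Mapping.lookup x c else 0)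
      = (\<Sum>j<k. if j = i then Poly_Mapping.lookup x c else 0)"
      using i(2) by (intro sum.cong) (auto dest: dual_classes_wt_unique[OF i(2)])
    with i(1) show ?thesis by (simp add: lookup_sum lookup_wt_component)
  next
    case False
    then have "Poly_Mapping.lookup x c = 0" by (simp add: in_keys_iff)
    then show ?thesis by (simp add: lookup_sum lookup_wt_component cong: if_cong)
  qed
qed

lemma wt_component_sum:
  assumes "\<And>i. i < k \<Longrightarrow> m i \<in> free_Z (dual_classes_wt i)" "j < k"
  shows "wt_component j (\<Sum>i<k. m i) = m j"
proof (rule poly_mapping_eqI)
  fix c
  have keys: "c \<in> dual_classes_wt i" if "i < k" "Poly_Mapping.lookup (m i) c \<noteq> 0" for i
    using assms(1)[OF that(1)] that(2) by (auto simp: in_keys_iff)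
  show "Poly_Mapping.lookup (wt_component j (\<Sum>i<k. m i)) c = Poly_Mapping.lookup (m j) c"
  proof (cases "c \<in> dual_classes_wt j")
    case True
    have "(\<Sum>i<k. Poly_Mapping.lookup (m i) c)
        = (\<Sum>i<k. if i = j then Poly_Mapping.lookup (m j) c else 0)"
    proof (intro sum.cong refl)
      fix i assume "i \<in> {..<k}"
      then show "Poly_Mapping.lookup (m i) c = (if i = j then Poly_Mapping.lookup (m j) c else 0)"
        using keys[of i] dual_classes_wt_unique[OF True, of i] by (cases "i = j") auto
    qed
    with True assms(2) show ?thesis by (simp add: lookup_wt_component lookup_sum)
  next
    case False
    with keys[OF assms(2)] show ?thesis by (auto simp: lookup_wt_component)
  qed
qed

lemma zeta_lin_wt_component_frag_extend:
  "zeta_lin (wt_component j (frag_extend f l)) n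
    = (\<Sum>c\<in>Poly_Mapping.keys l. of_int (Poly_Mapping.lookup l c) * zeta_lin (wt_component j (f c)) n)"
  unfolding frag_extend_def[of f] wt_component_def
  by (simp add: frag_extend_sum frag_extend_cmul zeta_lin_sum zeta_lin_cmul)

lemma zeta_lin_wt_component_cls:
  assumes "a \<in> admissible"
  shows "zeta_lin (wt_component j (frag_of (cls a))) n = (if weight a = j then zeta_tail a n else 0)"
  using assms by (simp add: wt_component_def cls_in_dual_classes_wt zeta_class_cls)

lemma weight_comp_init_less: "a \<in> admissible \<Longrightarrow> a \<noteq> [] \<Longrightarrow> weight (comp_init a) < weight a"
  using weight_comp_init[of a] last_pos[of a] by simp

lemma weight_comp_fin_less:
  assumes "a \<in> admissible" "a \<noteq> []"
  shows "weight (comp_fin a) < weight a"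
  using weight_comp_fin[OF assms] last_pos[of "dual a"] assms by simp

lemma weight_comp_mid_less:
  assumes "a \<in> admissible" "a \<noteq> []"
  shows "weight (comp_mid a) < weight a"
proof (cases "comp_fin a = []")
  case True
  then show ?thesis using weight_comp_fin_less[OF assms] by (simp add: comp_mid_def comp_init_def)
next
  case False
  then show ?thesis
    using weight_comp_fin_less[OF assms] weight_comp_init_less[of "comp_fin a"] assms
    by (simp add: comp_mid_def)
qed

lemma zeta_class_pred:
  assumes c: "c \<in> dual_classes_wt k" and "k \<ge> 1" "n \<ge> 1"
  shows "zeta_class c (n - 1) = zeta_class c n
    + (\<Sum>j<k. inverse (real n) ^ (k - j) * zeta_lin (wt_component j (alpha_class c)) n)"
proof -
  obtain a where a: "a \<in> admissible" "weight a = k" "c = cls a"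
    using c by (rule dual_classes_wtE)
  have "a \<noteq> []" using a(2) \<open>k \<ge> 1\<close> by (auto simp: weight_def)
  \<comment> \<open>The correction term as an additive function of the combination, so that it can
    be evaluated on the three classes of \<open>alpha_class c\<close> one at a time.\<close>
  define L where "L y = (\<Sum>j<k. inverse (real n) ^ (k - j) * zeta_lin (wt_component j y) n)" for y
  have L_add: "L (x + y) = L x + L y" for x y
    unfolding L_def wt_component_def
    by (simp add: frag_extend_add zeta_lin_add distrib_left sum.distrib)
  have L_cls: "L (frag_of (cls b)) = inverse (real n) ^ (k - weight b) * zeta_tail b n"
    if "b \<in> admissible" "weight b < k" for b
  proof -
    have "L (frag_of (cls b)) = (\<Sum>j<k. if j = weight b
        then inverse (real n) ^ (k - weight b) * zeta_tail b n else 0)"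
      unfolding L_def using that(1) by (intro sum.cong) (auto simp: zeta_lin_wt_component_cls)
    with that(2) show ?thesis by simp
  qed
  have "L (alpha_class c)
    = inverse (real n) ^ (weight a - weight (comp_init a)) * zeta_tail (comp_init a) n
    + inverse (real n) ^ (weight a - weight (comp_mid a)) * zeta_tail (comp_mid a) n
    + inverse (real n) ^ (weight a - weight (comp_fin a)) * zeta_tail (comp_fin a) n"
    unfolding a(3) alpha_class_cls[OF a(1)] L_add
    using a(1,2) weight_comp_init_less[OF a(1) \<open>a \<noteq> []\<close>] weight_comp_mid_less[OF a(1) \<open>a \<noteq> []\<close>]
      weight_comp_fin_less[OF a(1) \<open>a \<noteq> []\<close>]
    by (simp add: L_cls)
  then show ?thesis
    using zeta_tail_pred[OF a(1) \<open>a \<noteq> []\<close> \<open>n \<ge> 1\<close>] a(1)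
    unfolding L_def by (simp add: a(3) zeta_class_cls)
qed

lemma zeta_lin_pred:
  assumes l: "l \<in> free_Z (dual_classes_wt k)" and "k \<ge> 1" "n \<ge> 1"
  shows "zeta_lin l (n - 1) = zeta_lin l n
    + (\<Sum>j<k. inverse (real n) ^ (k - j) * zeta_lin (wt_component j (alpha l)) n)"
proof -
  have "zeta_lin l (n - 1) = (\<Sum>c\<in>Poly_Mapping.keys l. of_int (Poly_Mapping.lookup l c) *
      (zeta_class c n
        + (\<Sum>j<k. inverse (real n) ^ (k - j) * zeta_lin (wt_component j (alpha_class c)) n)))"
    unfolding zeta_lin_def[of l] using l assms zeta_class_pred by (intro sum.cong) auto
  also have "\<dots> = zeta_lin l n + (\<Sum>c\<in>Poly_Mapping.keys l. \<Sum>j<k. inverse (real n) ^ (k - j) *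
      (of_int (Poly_Mapping.lookup l c) * zeta_lin (wt_component j (alpha_class c)) n))"
    by (simp add: zeta_lin_def distrib_left sum.distrib sum_distrib_left mult_ac)
  also have "(\<Sum>c\<in>Poly_Mapping.keys l. \<Sum>j<k. inverse (real n) ^ (k - j) *
      (of_int (Poly_Mapping.lookup l c) * zeta_lin (wt_component j (alpha_class c)) n))
    = (\<Sum>j<k. inverse (real n) ^ (k - j) * zeta_lin (wt_component j (alpha l)) n)"
    unfolding alpha_def zeta_lin_wt_component_frag_extend sum_distrib_left by (rule sum.swap)
  finally show ?thesis .
qed

text \<open>Translates between sums over weights, as they come from \<open>alpha\<close>, and sums
  over classes, as the general results on graded families need them.\<close>

lemma sum_weighted_zeta_lin:
  "(\<Sum>j<k. w j * zeta_lin (wt_component j y) n)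
    = (\<Sum>c\<in>(\<Union>j<k. dual_classes_wt j).
        of_int (Poly_Mapping.lookup y c) * w (class_weight c) * zeta_class c n)"
proof -
  have "(\<Sum>c\<in>(\<Union>j<k. dual_classes_wt j).
        of_int (Poly_Mapping.lookup y c) * w (class_weight c) * zeta_class c n)
    = (\<Sum>j<k. \<Sum>c\<in>dual_classes_wt j.
        of_int (Poly_Mapping.lookup y c) * w (class_weight c) * zeta_class c n)"
    by (intro sum.UNION_disjoint) (auto simp: finite_dual_classes_wt dest: dual_classes_wt_unique)
  also have "\<dots> = (\<Sum>j<k. w j * zeta_lin (wt_component j y) n)"
    unfolding zeta_lin_wt_component sum_distrib_left
    by (intro sum.cong) (auto simp: class_weight_eq)
  finally show ?thesis ..
qed

section \<open>Decay at infinity and separation of the weights\<close>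

lemma zeta_class_tendsto_0: "c \<in> dual_classes_wt k \<Longrightarrow> zeta_class c \<longlonglongrightarrow> 0"
proof (elim dual_classes_wtE)
  fix a assume a: "a \<in> admissible" "c = cls a"
  then have "zeta_class c = zeta_tail a" by (simp add: fun_eq_iff zeta_class_cls)
  with a show ?thesis by (simp add: zeta_tail_tendsto_0)
qed

lemma zeta_lin_tendsto_0:
  assumes "l \<in> free_Z (dual_classes_wt k)"
  shows "zeta_lin l \<longlonglongrightarrow> 0"
proof -
  have "(\<lambda>n. \<Sum>c\<in>Poly_Mapping.keys l. of_int (Poly_Mapping.lookup l c) * zeta_class c n)
    \<longlonglongrightarrow> (\<Sum>c\<in>Poly_Mapping.keys l. of_int (Poly_Mapping.lookup l c) * 0)"
    using assms by (intro tendsto_intros zeta_class_tendsto_0[of _ k]) auto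
  then show ?thesis by (simp add: zeta_lin_def[abs_def])
qed

text \<open>The general results are applied to the classes of weight below k: a finite set, closed
  under the recursion because \<open>alpha\<close> lowers the weight, with the matrix of
  \<open>alpha\<close> as coefficients and a single class in weight 0.\<close>

lemma weight_components_vanish:
  assumes "\<forall>\<^sub>F n in sequentially.
      (\<Sum>j<k. inverse (real n) ^ (k - j) * zeta_lin (wt_component j y) n) = 0"
    and "j < k"
  shows "\<forall>\<^sub>F n in sequentially. zeta_lin (wt_component j y) n = 0"
proof -
  let ?X = "\<Union>j<k. dual_classes_wt j"
  let ?s = "\<lambda>c n. complex_of_real (zeta_class c n)"
  have fin: "finite ?X" by (simp add: finite_dual_classes_wt)
  have X: "c \<in> dual_classes_wt (class_weight c) \<and> class_weight c < k" if "c \<in> ?X" for c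
    using that class_weight_eq by auto
  have below: "{c \<in> ?X. class_weight c < i} = (\<Union>j<i. dual_classes_wt j)" if "i \<le> k" for i
  proof (intro equalityI subsetI)
    fix c assume "c \<in> {c \<in> ?X. class_weight c < i}"
    then show "c \<in> (\<Union>j<i. dual_classes_wt j)" using X by blast
  next
    fix c assume "c \<in> (\<Union>j<i. dual_classes_wt j)"
    with that show "c \<in> {c \<in> ?X. class_weight c < i}" by (auto simp: class_weight_eq)
  qed
  have Nil: "c = cls []" if "c \<in> ?X" "class_weight c = 0" for c
    using X[OF that(1)] that(2) dual_classes_wt_0 by simp
  have "\<exists>I\<subseteq>?X. rational_independent ?s I \<and>
    (\<forall>b\<in>?X. \<exists>c. \<forall>\<^sub>F n in sequentially. ?s b n = (\<Sum>i\<in>{i\<in>I. class_weight i = class_weight b}. c i * ?s i n))"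
  proof (rule graded_rational_basis[OF fin, where a = "\<lambda>b x. of_int (Poly_Mapping.lookup (alpha_class b) x)"])
    fix b assume b: "b \<in> ?X" and pos: "0 < class_weight b"
    show "\<forall>\<^sub>F n in sequentially. ?s b (n - 1) = ?s b n +
        (\<Sum>c\<in>{c \<in> ?X. class_weight c < class_weight b}. of_int (Poly_Mapping.lookup (alpha_class b) c)
          * inverse (of_nat n) ^ (class_weight b - class_weight c) * ?s c n)"
      using eventually_ge_at_top[of 1]
    proof eventually_elim
      case (elim n)
      have "zeta_class b (n - 1) = zeta_class b n
        + (\<Sum>j<class_weight b. inverse (real n) ^ (class_weight b - j)
             * zeta_lin (wt_component j (alpha_class b)) n)"
        using X[OF b] pos elim by (intro zeta_class_pred) auto
      also have "(\<Sum>j<class_weight b. inverse (real n) ^ (class_weight b - j)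
             * zeta_lin (wt_component j (alpha_class b)) n)
        = (\<Sum>c\<in>{c \<in> ?X. class_weight c < class_weight b}. of_int (Poly_Mapping.lookup (alpha_class b) c)
            * inverse (real n) ^ (class_weight b - class_weight c) * zeta_class c n)"
        using X[OF b] by (subst below) (auto simp: sum_weighted_zeta_lin[where w = "\<lambda>j. inverse (real n) ^ (class_weight b - j)"])
      finally show ?case by simp
    qed
  next
    fix b assume b: "b \<in> ?X" and zero: "class_weight b = 0"
    have "?s b (n - 1) = (4 - 2 / of_nat n) * ?s b n \<and> ?s b n \<noteq> 0" if "n \<ge> 1" for n
    proof -
      have "zeta_class b (n - 1) = (4 - 2 / real n) * zeta_class b n" "zeta_class b n \<noteq> 0"
        unfolding Nil[OF b zero] using zeta_tail_Nil_pred[OF that] zeta_tail_Nil_nonzero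
        by (simp_all add: zeta_class_cls)
      then show ?thesis by simp
    qed
    then show "\<forall>\<^sub>F n in sequentially. ?s b (n - 1) = (4 - 2 / of_nat n) * ?s b n \<and> ?s b n \<noteq> 0"
      unfolding eventually_sequentially by blast
  next
    fix b b' assume "b \<in> ?X" "b' \<in> ?X" "class_weight b = 0" "class_weight b' = 0"
    then show "b = b'" using Nil by metis
  next
    fix b assume "b \<in> ?X"
    then have "zeta_class b \<longlonglongrightarrow> 0" using zeta_class_tendsto_0 by blast
    from tendsto_of_real[OF this] show "?s b \<longlonglongrightarrow> 0" by simp
  qed
  then obtain I where I: "I \<subseteq> ?X" "rational_independent ?s I"
    "\<forall>b\<in>?X. \<exists>c. \<forall>\<^sub>F n in sequentially. ?s b n = (\<Sum>i\<in>{i\<in>I. class_weight i = class_weight b}. c i * ?s i n)"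
    by blast
  have rel: "\<forall>\<^sub>F n in sequentially. (\<Sum>c\<in>?X. of_int (Poly_Mapping.lookup y c)
      * inverse (of_nat n) ^ (k - class_weight c) * ?s c n) = 0"
    using assms(1)
  proof eventually_elim
    case (elim n)
    have "complex_of_real (\<Sum>c\<in>?X. of_int (Poly_Mapping.lookup y c)
        * inverse (real n) ^ (k - class_weight c) * zeta_class c n) = 0"
      using elim sum_weighted_zeta_lin[where w = "\<lambda>j. inverse (real n) ^ (k - j)"] by simp
    then show ?case by simp
  qed
  have level: "{c \<in> ?X. class_weight c = j} = dual_classes_wt j"
    using assms(2) X by (auto simp: class_weight_eq)
  from graded_components_vanish[OF fin I rel, of j]
  have "\<forall>\<^sub>F n in sequentially. (\<Sum>c\<in>dual_classes_wt j. of_int (Poly_Mapping.lookup y c) * ?s c n) = 0"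
    unfolding level .
  then show ?thesis
  proof eventually_elim
    case (elim n)
    then have "complex_of_real (zeta_lin (wt_component j y) n) = 0"
      unfolding zeta_lin_wt_component by simp
    then show ?case by simp
  qed
qed

lemma alpha_components_eventually_vanish:
  assumes l: "l \<in> free_Z (dual_classes_wt k)" and "k \<ge> 1"
    and ev: "\<forall>\<^sub>F n in sequentially. zeta_lin l n = 0" and "j < k"
  shows "\<forall>\<^sub>F n in sequentially. zeta_lin (wt_component j (alpha l)) n = 0"
proof (rule weight_components_vanish[OF _ \<open>j < k\<close>])
  show "\<forall>\<^sub>F n in sequentially.
      (\<Sum>j<k. inverse (real n) ^ (k - j) * zeta_lin (wt_component j (alpha l)) n) = 0"
    using ev eventually_pred[OF ev] eventually_ge_at_top[of 1]
    by eventually_elim (use zeta_lin_pred[OF l \<open>k \<ge> 1\<close>] in simp)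
qed

lemma zeta_lin_eq_0_if_alpha_components_vanish:
  assumes l: "l \<in> free_Z (dual_classes_wt k)" and "k \<ge> 1"
    and van: "\<And>j n. j < k \<Longrightarrow> zeta_lin (wt_component j (alpha l)) n = 0"
  shows "zeta_lin l n = 0"
proof -
  have "zeta_lin l n = zeta_lin l 0" for n
  proof (induction n)
    case (Suc n)
    with zeta_lin_pred[OF l \<open>k \<ge> 1\<close>, of "Suc n"] van show ?case by simp
  qed simp
  then have "zeta_lin l = (\<lambda>_. zeta_lin l 0)" by (rule ext)
  with zeta_lin_tendsto_0[OF l] have "(\<lambda>_::nat. zeta_lin l 0) \<longlonglongrightarrow> 0" by metis
  then have "zeta_lin l 0 = 0" by (simp add: LIMSEQ_const_iff)
  with \<open>zeta_lin l n = zeta_lin l 0\<close> show ?thesis by simp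
qed

text \<open>Strong induction on the weight: the components of \<open>alpha l\<close> vanish for
  large n, hence everywhere by induction, and then \<open>zeta_lin l\<close> is constant with limit
  0. In weight 0 the function is a multiple of 1/binomial(2n, n), which has no zeros.\<close>

lemma zeta_lin_eq_0_if_eventually:
  assumes "l \<in> free_Z (dual_classes_wt k)" "\<forall>\<^sub>F n in sequentially. zeta_lin l n = 0"
  shows "zeta_lin l n = 0"
  using assms
proof (induction k arbitrary: l n rule: less_induct)
  case (less k)
  show ?case
  proof (cases "k = 0")
    case True
    have z: "zeta_lin l n = of_int (Poly_Mapping.lookup l (cls [])) * zeta_tail [] n" for n
      using less.prems(1) unfolding True dual_classes_wt_0
      by (subst zeta_lin_superset[of "{cls []}"]) (auto simp: zeta_class_cls)
    obtain N where "zeta_lin l N = 0"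
      using eventually_happens[OF less.prems(2)] by auto
    then show ?thesis using zeta_tail_Nil_nonzero[of N] by (simp add: z)
  next
    case False
    then have "k \<ge> 1" by simp
    show ?thesis
    proof (rule zeta_lin_eq_0_if_alpha_components_vanish[OF less.prems(1) \<open>k \<ge> 1\<close>])
      fix j n assume "j < k"
      then show "zeta_lin (wt_component j (alpha l)) n = 0"
        using alpha_components_eventually_vanish[OF less.prems(1) \<open>k \<ge> 1\<close> less.prems(2)]
          wt_component_in_free_Z by (intro less.IH)
    qed
  qed
qed

section \<open>Relations of a fixed weight\<close>

lemma rel_M_wt_iff:
  "l \<in> rel_M_wt k \<longleftrightarrow> l \<in> free_Z (dual_classes_wt k) \<and> (\<forall>n. zeta_lin l n = 0)"
  unfolding rel_M_wt_def rel_M_def using dual_classes_wt_subset[of k] by auto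

lemma rel_M_wt_iff_alpha_components:
  assumes "k \<ge> 1" and l: "l \<in> free_Z (dual_classes_wt k)"
  shows "l \<in> rel_M_wt k \<longleftrightarrow> (\<forall>j<k. wt_component j (alpha l) \<in> rel_M_wt j)"
proof
  assume "l \<in> rel_M_wt k"
  then have ev: "\<forall>\<^sub>F n in sequentially. zeta_lin l n = 0" by (simp add: rel_M_wt_iff)
  show "\<forall>j<k. wt_component j (alpha l) \<in> rel_M_wt j"
  proof (intro allI impI)
    fix j assume "j < k"
    from zeta_lin_eq_0_if_eventually[OF wt_component_in_free_Z
        alpha_components_eventually_vanish[OF l \<open>k \<ge> 1\<close> ev this]]
    show "wt_component j (alpha l) \<in> rel_M_wt j"
      unfolding rel_M_wt_iff using wt_component_in_free_Z by blast
  qed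
next
  assume "\<forall>j<k. wt_component j (alpha l) \<in> rel_M_wt j"
  then have "zeta_lin l n = 0" for n
    using zeta_lin_eq_0_if_alpha_components_vanish[OF l \<open>k \<ge> 1\<close>] by (simp add: rel_M_wt_iff)
  with l show "l \<in> rel_M_wt k" by (simp add: rel_M_wt_iff)
qed

lemma keys_alpha:
  assumes l: "l \<in> free_Z (dual_classes_wt k)" and "k \<ge> 1"
  shows "Poly_Mapping.keys (alpha l) \<subseteq> (\<Union>j<k. dual_classes_wt j)"
proof -
  have "Poly_Mapping.keys (alpha_class c) \<subseteq> (\<Union>j<k. dual_classes_wt j)"
    if "c \<in> dual_classes_wt k" for c
  proof -
    obtain a where a: "a \<in> admissible" "weight a = k" "c = cls a"
      using \<open>c \<in> dual_classes_wt k\<close> by (rule dual_classes_wtE)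
    have "a \<noteq> []" using a(2) \<open>k \<ge> 1\<close> by (auto simp: weight_def)
    have "Poly_Mapping.keys (alpha_class c)
        \<subseteq> {cls (comp_init a), cls (comp_mid a), cls (comp_fin a)}"
      unfolding a(3) alpha_class_cls[OF a(1)]
      using Poly_Mapping.keys_add[of "frag_of (cls (comp_init a)) + frag_of (cls (comp_mid a))"
          "frag_of (cls (comp_fin a))"]
        Poly_Mapping.keys_add[of "frag_of (cls (comp_init a))" "frag_of (cls (comp_mid a))"]
      by auto
    also have "\<dots> \<subseteq> (\<Union>j<k. dual_classes_wt j)"
      using a(1,2) weight_comp_init_less[OF a(1) \<open>a \<noteq> []\<close>]
        weight_comp_mid_less[OF a(1) \<open>a \<noteq> []\<close>] weight_comp_fin_less[OF a(1) \<open>a \<noteq> []\<close>]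
      by (simp add: cls_in_dual_classes_wt)
    finally show ?thesis .
  qed
  moreover have "Poly_Mapping.keys l \<subseteq> dual_classes_wt k" using l by simp
  moreover have "Poly_Mapping.keys (alpha l)
      \<subseteq> (\<Union>c\<in>Poly_Mapping.keys l. Poly_Mapping.keys (alpha_class c))"
    unfolding alpha_def by (rule keys_frag_extend)
  ultimately show ?thesis by blast
qed

text \<open>A class has only one weight, so the sum is direct: the summands of an element are its
  weight components.\<close>

lemma in_internal_sum_below_iff:
  assumes "Poly_Mapping.keys x \<subseteq> (\<Union>j<k. dual_classes_wt j)"
  shows "x \<in> internal_sum_below k rel_M_wt \<longleftrightarrow> (\<forall>j<k. wt_component j x \<in> rel_M_wt j)"
proof
  assume "x \<in> internal_sum_below k rel_M_wt"
  then obtain m where m: "x = (\<Sum>j<k. m j)" "\<And>j. j < k \<Longrightarrow> m j \<in> rel_M_wt j"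
    unfolding internal_sum_below_def by blast
  then show "\<forall>j<k. wt_component j x \<in> rel_M_wt j"
    using wt_component_sum[of k m] by (simp add: rel_M_wt_iff del: carrier_free_Abelian_group_iff)
next
  assume "\<forall>j<k. wt_component j x \<in> rel_M_wt j"
  then show "x \<in> internal_sum_below k rel_M_wt"
    unfolding internal_sum_below_def using sum_wt_components[OF assms]
    by (intro CollectI exI[of _ "\<lambda>j. wt_component j x"]) auto
qed

theorem theorem20:
  fixes k :: nat
  assumes "k \<ge> 1"
  shows "rel_M_wt k
           = {l \<in> free_Z (dual_classes_wt k). alpha_wt k l \<in> internal_sum_below k rel_M_wt}
       \<and> {l \<in> free_Z (dual_classes_wt k). alpha_wt k l \<in> internal_sum_below k rel_M_wt}
           = (\<Inter>k'\<in>{0..<k}. {l \<in> free_Z (dual_classes_wt k). alpha_comp k' k l \<in> rel_M_wt k'})"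
proof -
  let ?F = "free_Z (dual_classes_wt k)"
  have sum: "alpha_wt k l \<in> internal_sum_below k rel_M_wt
      \<longleftrightarrow> (\<forall>j<k. wt_component j (alpha l) \<in> rel_M_wt j)" if "l \<in> ?F" for l
    using in_internal_sum_below_iff[OF keys_alpha[OF that assms]] that by (simp add: alpha_wt_def)
  have comp: "alpha_comp j k l = wt_component j (alpha l)" if "l \<in> ?F" for j l
    using that by (simp add: alpha_comp_def alpha_wt_def)
  have "rel_M_wt k \<subseteq> ?F" by (auto simp: rel_M_wt_iff)
  then have "rel_M_wt k = {l \<in> ?F. alpha_wt k l \<in> internal_sum_below k rel_M_wt}"
    using rel_M_wt_iff_alpha_components[OF assms] sum by blast
  moreover have "l \<in> ?F \<and> alpha_wt k l \<in> internal_sum_below k rel_M_wt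
      \<longleftrightarrow> (\<forall>j\<in>{0..<k}. l \<in> ?F \<and> alpha_comp j k l \<in> rel_M_wt j)" for l
  proof (cases "l \<in> ?F")
    case True
    then show ?thesis unfolding sum[OF True] comp[OF True] by auto
  next
    case False
    \<comment> \<open>The index set is non-empty since k \<ge> 1, so the intersection stays inside
      the domain of \<open>alpha_wt k\<close>.\<close>
    moreover have "0 \<in> {0..<k}" using assms by simp
    ultimately show ?thesis by blast
  qed
  then have "{l \<in> ?F. alpha_wt k l \<in> internal_sum_below k rel_M_wt}
      = (\<Inter>k'\<in>{0..<k}. {l \<in> ?F. alpha_comp k' k l \<in> rel_M_wt k'})"
    by blast
  ultimately show ?thesis by blast
qed

end
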